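(* Let $m\ge 2$, $\rho\in(0,1)$, $\vec a=(a_1,\ldots,a_m)\in\mathbb{R}^m$, and suppose that the iterated function system $\mathcal{I}=\{f_j\}_{j=1}^m$, $f_j(x)=\rho x+a_j$, satisfies the strong separation condition. Let $\vec p=(p_1,\ldots,p_m)$ be a positive probability vector and let $\mu_\rho$ be the homogeneous self-similar measure on $\mathbb{R}$ associated with $\mathcal{I}$ and $\vec p$. Let $\varphi\in C^2(\mathbb{R})$ (real-valued) with $\varphi''>0$ on $\mathbb{R}$. Then for any strictly increasing sequence $\{s_n\}_{n\ge1}$ of positive integers, the sequence $\{s_n\varphi(x)\}_{n\ge1}$ is equidistributed modulo 1 for $\mu_\rho$-almost every $x$. In particular, for $\mu_\rho$-almost every $x$, the number $\varphi(x)$ is $b$-normal for every integer base $b>1$.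
   Context: For a measurable map $f:\mathbb{R}\to\mathbb{R}$ and a Borel probability measure $\mu$ on $\mathbb{R}$, the push-forward $f\mu$ is defined by $f\mu(A)=\mu(f^{-1}(A))$ for Borel $A\subset\mathbb{R}$. The attractor of $\mathcal{I}=\{f_j\}_{j=1}^m$ is the unique non-empty compact set $K\subset\mathbb{R}$ with $K=\bigcup_{j=1}^m f_j(K)$. The strong separation condition holds for $\mathcal{I}$ if the sets $f_1(K),\ldots,f_m(K)$ are pairwise disjoint. A positive probability vector is $\vec p=(p_1,\ldots,p_m)$ with $p_j>0$ for every $j$ and $\sum_{j=1}^m p_j=1$. The homogeneous self-similar measure $\mu_\rho$ associated with $\mathcal{I}$ and $\vec p$ is the unique Borel probability measure supported on $K$ with $\mu_\rho=\sum_{j=1}^m p_j\, f_j\mu_\rho$. A sequence $\{x_n\}_{n\ge1}$ of real numbers is equidistributed modulo 1 if for every subinterval $I\subset[0,1]$, $\lim_{N\to\infty}\frac1N\#\{n:1\le n\le N,\ \{x_n\}\in I\}=|I|$, where here $\{x_n\}$ denotes the fractional part of $x_n$ and $|I|$ the length of $I$. For an integer $b>1$, a real number $x$ is $b$-normal (normal in base $b$) if the sequence $\{b^n x\}_{n\ge1}$ is equidistributed modulo 1. *)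

theory Defs
  imports "HOL-Probability.Probability"
begin

definition is_attractor :: "nat \<Rightarrow> (nat \<Rightarrow> real \<Rightarrow> real) \<Rightarrow> real set \<Rightarrow> bool" where
  "is_attractor m f K \<longleftrightarrow> K \<noteq> {} \<and> compact K \<and> K = (\<Union>j\<in>{1..m}. f j ` K)"

definition strong_separation :: "nat \<Rightarrow> (nat \<Rightarrow> real \<Rightarrow> real) \<Rightarrow> real set \<Rightarrow> bool" where
  "strong_separation m f K \<longleftrightarrow> disjoint_family_on (\<lambda>j. f j ` K) {1..m}"

definition positive_probability_vector :: "nat \<Rightarrow> (nat \<Rightarrow> real) \<Rightarrow> bool" where
  "positive_probability_vector m p \<longleftrightarrow> (\<forall>j\<in>{1..m}. p j > 0) \<and> (\<Sum>j=1..m. p j) = 1"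

definition self_similar_measure ::
    "nat \<Rightarrow> (nat \<Rightarrow> real \<Rightarrow> real) \<Rightarrow> (nat \<Rightarrow> real) \<Rightarrow> real set \<Rightarrow> real measure \<Rightarrow> bool" where
  "self_similar_measure m f p K \<mu> \<longleftrightarrow>
     sets \<mu> = sets borel \<and> prob_space \<mu> \<and> emeasure \<mu> (- K) = 0 \<and>
     (\<forall>A\<in>sets borel. measure \<mu> A = (\<Sum>j=1..m. p j * measure (distr \<mu> borel (f j)) A))"

definition homogeneous_ifs :: "real \<Rightarrow> (nat \<Rightarrow> real) \<Rightarrow> nat \<Rightarrow> real \<Rightarrow> real" where
  "homogeneous_ifs \<rho> a j x = \<rho> * x + a j"

definition C2 :: "(real \<Rightarrow> real) \<Rightarrow> bool" where
  "C2 \<phi> \<longleftrightarrow> \<phi> differentiable_on UNIV \<and> deriv \<phi> differentiable_on UNIV \<and>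
     continuous_on UNIV (deriv (deriv \<phi>))"

text \<open>Sequences are indexed from 1, so the value at index 0 is irrelevant. The intervals
  may be open, closed, half-open or degenerate.\<close>

definition equidistributed_mod_1 :: "(nat \<Rightarrow> real) \<Rightarrow> bool" where
  "equidistributed_mod_1 x \<longleftrightarrow>
     (\<forall>I. is_interval I \<and> I \<subseteq> {0..1} \<longrightarrow>
        (\<lambda>N. real (card {n \<in> {1..N}. frac (x n) \<in> I}) / real N) \<longlonglongrightarrow> measure lborel I)"

definition normal_in_base :: "nat \<Rightarrow> real \<Rightarrow> bool" where
  "normal_in_base b x \<longleftrightarrow> equidistributed_mod_1 (\<lambda>n. real b ^ n * x)"

end

theory Submission
  imports Defs
begin

text \<open>
  By Weyl's criterion it is enough that, for every integer \<open>h \<noteq> 0\<close> and \<open>\<mu>\<close>-almost every \<open>x\<close>, the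
  averages of \<open>e(h s\<^sub>n \<phi>(x))\<close> tend to \<open>0\<close>, where \<open>e(t) = exp(2 \<pi> i t)\<close>. The correlation of the
  \<open>n\<close>-th and \<open>k\<close>-th of these functions is the Fourier transform of the image measure \<open>\<phi>\<mu>\<close> at a
  frequency of modulus at least \<open>\<bar>n - k\<bar>\<close>, since \<open>s\<close> increases strictly through the integers. So a
  power decay of this Fourier transform (\<open>fourier_decay_of_image\<close>) makes the functions weakly
  correlated, and a second moment estimate along a sparse sequence of \<open>N\<close>
  (\<open>averages_tendsto_0_AE\<close>) gives the almost sure convergence.

  The power decay combines the curvature of \<open>\<phi>\<close> with the structure of \<open>\<mu>\<close>. On a cylinder of
  diameter about \<open>\<rho>\<^sup>n\<close> the function \<open>\<phi>\<close> is affine up to \<open>O(\<rho>\<^sup>2\<^sup>n)\<close>, and \<open>\<mu>\<close> is there a scaled copy of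
  itself. Hence at a frequency \<open>\<xi>\<close> with \<open>\<bar>\<xi>\<bar> \<rho>\<^sup>2\<^sup>n\<close> small the Fourier transform of \<open>\<phi>\<mu>\<close> is, up to
  a small error, at most the \<open>\<mu>\<close>-average of the modulus of the Fourier transform of \<open>\<mu>\<close> at \<open>\<xi> \<rho>\<^sup>n \<phi>'(z)\<close>
  (\<open>fourier_linearization\<close>). Strict convexity spreads these frequencies out: \<open>\<phi>'\<close> is bi-Lipschitz
  and \<open>\<mu>\<close> has positive dimension (\<open>frostman\<close>, where the separation of the pieces enters), so no
  unit interval of frequencies carries much mass.

  The Fourier transform of \<open>\<mu>\<close> need not tend to \<open>0\<close>, but by an argument of Erdos and Kahane it is
  small outside a sparse set. It is the product of the values of a trigonometric polynomial
  \<open>mask\<close> along the geometric progression \<open>\<rho>\<^sup>k t\<close>, and a factor is close to \<open>1\<close> in modulus only if a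
  fixed multiple of \<open>\<rho>\<^sup>k t\<close> is close to an integer. If two consecutive multiples are both near
  integers, the smaller multiple determines the integer nearest to the larger one, so the sequences
  of nearest integers with few bad factors are few. Here the count is replaced by an integral: a high power of the product is integrated over the
  tree of integer sequences, and the power is chosen so large that a bad step costs more than the
  number of branches it opens (\<open>erdos_kahane_integral\<close>, \<open>char_average_decay\<close>).
\<close>

section \<open>Weyl's criterion\<close>

text \<open>
  Continuity on the circle is included because it makes the integral on the right exist, hence
  additive in \<open>g\<close>.
\<close>

definition averages_to_integral :: "(nat \<Rightarrow> complex) \<Rightarrow> (complex \<Rightarrow> complex) \<Rightarrow> bool" where
  "averages_to_integral z g \<longleftrightarrow> continuous_on (sphere 0 1) g \<and>
     (\<lambda>N. (\<Sum>n=1..N. g (z n)) / of_nat N) \<longlonglongrightarrow> integral {0..1} (\<lambda>t. g (cis (2 * pi * t)))"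

lemma integrable_on_circle:
  fixes g :: "complex \<Rightarrow> 'a::banach"
  assumes "continuous_on (sphere 0 1) g"
  shows "(\<lambda>t. g (cis (2 * pi * t))) integrable_on {0..1}"
  by (intro integrable_continuous_interval continuous_on_compose2[OF assms] continuous_intros) auto

lemma averages_to_integral_add:
  assumes "averages_to_integral z f" "averages_to_integral z g"
  shows "averages_to_integral z (\<lambda>w. f w + g w)"
proof -
  have "integral {0..1} (\<lambda>t. f (cis (2 * pi * t)) + g (cis (2 * pi * t)))
      = integral {0..1} (\<lambda>t. f (cis (2 * pi * t))) + integral {0..1} (\<lambda>t. g (cis (2 * pi * t)))"
    using assms by (intro integral_add integrable_on_circle) (auto simp: averages_to_integral_def)
  then show ?thesis
    using assms unfolding averages_to_integral_def
    by (auto simp: sum.distrib add_divide_distrib intro!: continuous_intros tendsto_add)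
qed

lemma averages_to_integral_cmult:
  assumes "averages_to_integral z f"
  shows "averages_to_integral z (\<lambda>w. c * f w)"
  using assms unfolding averages_to_integral_def
  by (auto simp flip: sum_distrib_left times_divide_eq_right intro!: continuous_intros tendsto_mult)

lemma averages_to_integral_cong:
  assumes "averages_to_integral z f" "\<And>n. norm (z n) = 1" "\<And>w. norm w = 1 \<Longrightarrow> f w = g w"
  shows "averages_to_integral z g"
proof -
  have "continuous_on (sphere 0 1) f \<longleftrightarrow> continuous_on (sphere 0 1) g"
    using assms(3) by (intro continuous_on_cong) auto
  then show ?thesis
    using assms by (simp add: averages_to_integral_def)
qed

text \<open>
  On the unit circle a real linear functional is \<open>c w + cnj c w\<^sup>-\<^sup>1\<close>, so multiplying by it only shifts
  the characters \<open>w powi k\<close>. The auxiliary factor \<open>g\<close> is there for products of polynomials: the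
  second factor is absorbed into it.
\<close>

lemma averages_to_integral_polynomial_mult:
  assumes "real_polynomial_function f" and z: "\<And>n. norm (z n) = 1"
    and "\<And>k::int. averages_to_integral z (\<lambda>w. g w * w powi k)"
  shows "averages_to_integral z (\<lambda>w. of_real (f w) * g w * w powi k)"
  using assms(1,3)
proof (induction f arbitrary: g k rule: real_polynomial_function.induct)
  case (linear f)
  interpret f: bounded_linear f by fact
  define c where "c = (of_real (f 1) - \<i> * of_real (f \<i>)) / 2"
  have f: "of_real (f w) = c * w + cnj c * cnj w" for w
  proof -
    have "f w = f (Re w *\<^sub>R 1 + Im w *\<^sub>R \<i>)"
      by (rule arg_cong[where f = f]) (auto simp: complex_eq_iff)
    also have "\<dots> = Re w * f 1 + Im w * f \<i>"
      by (simp only: f.add f.scaleR real_scaleR_def)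
    finally show ?thesis
      by (auto simp: complex_eq_iff c_def field_simps)
  qed
  show ?case
  proof (rule averages_to_integral_cong[OF _ z])
    show "averages_to_integral z
        (\<lambda>w. c * (g w * w powi (k + 1)) + cnj c * (g w * w powi (k - 1)))"
      by (intro averages_to_integral_add averages_to_integral_cmult linear)
    fix w :: complex assume w: "norm w = 1"
    then have "w \<noteq> 0" by auto
    have "cnj w = inverse w"
      using complex_norm_square[of w] w by (intro inverse_unique[symmetric]) (auto simp: mult.commute)
    with \<open>w \<noteq> 0\<close> show "c * (g w * w powi (k + 1)) + cnj c * (g w * w powi (k - 1))
        = of_real (f w) * g w * w powi k"
      by (simp add: f power_int_add power_int_diff field_simps)
  qed
next
  case (const c)
  show ?case
    using averages_to_integral_cmult[OF const] by (simp add: mult.assoc)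
next
  case (add f1 f2)
  show ?case
    using averages_to_integral_add[OF add.IH(1)[OF add.prems] add.IH(2)[OF add.prems]]
    by (simp add: algebra_simps)
next
  case (mult f1 f2)
  show ?case
    using mult.IH(1)[of "\<lambda>w. of_real (f2 w) * g w", OF mult.IH(2)[OF mult.prems]]
    by (simp add: algebra_simps)
qed

lemma integral_character:
  "integral {0..1} (\<lambda>t. cis (2 * pi * t) powi k) = (if k = 0 then 1 else 0)"
proof (cases "k = 0")
  case False
  have "((\<lambda>t. cis (2 * pi * k * t)) has_integral
      (cis (2 * pi * k * 1) / (2 * pi * k * \<i>) - cis (2 * pi * k * 0) / (2 * pi * k * \<i>))) {0..1}"
  proof (rule fundamental_theorem_of_calculus)
    fix t :: real
    have "((\<lambda>w. exp (2 * pi * k * \<i> * w) / (2 * pi * k * \<i>)) has_field_derivative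
        exp (2 * pi * k * \<i> * of_real t)) (at (of_real t))"
      using False by (auto intro!: derivative_eq_intros)
    from has_vector_derivative_real_field[OF this, of "{0..1}"]
    show "((\<lambda>t. cis (2 * pi * k * t) / (2 * pi * k * \<i>)) has_vector_derivative
        cis (2 * pi * k * t)) (at t within {0..1})"
      by (simp add: cis_conv_exp mult_ac)
  qed simp
  moreover have "cis (2 * pi * k * 1) = 1"
    using cis_multiple_2pi[of "of_int k"] by simp
  ultimately have "((\<lambda>t. cis (2 * pi * k * t)) has_integral 0) {0..1}"
    by simp
  then have "integral {0..1} (\<lambda>t. cis (2 * pi * k * t)) = 0"
    by (rule integral_unique)
  with False show ?thesis
    by (simp add: cis_power_int mult_ac)
qed simp

text \<open>
  Characters converge by hypothesis, real polynomials by
  \<open>averages_to_integral_polynomial_mult\<close>, and continuous functions by uniform approximation (Stone-Weierstrass on the circle).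
\<close>

lemma averages_of_continuous:
  fixes z :: "nat \<Rightarrow> complex" and F :: "complex \<Rightarrow> real"
  assumes z: "\<And>n. norm (z n) = 1"
    and weyl: "\<And>k::int. k \<noteq> 0 \<Longrightarrow> (\<lambda>N. (\<Sum>n=1..N. z n powi k) / of_nat N) \<longlonglongrightarrow> 0"
    and F: "continuous_on (sphere 0 1) F"
  shows "(\<lambda>N. (\<Sum>n=1..N. F (z n)) / real N) \<longlonglongrightarrow> integral {0..1} (\<lambda>t. F (cis (2 * pi * t)))"
    (is "?A F \<longlonglongrightarrow> ?I F")
proof -
  have chars: "averages_to_integral z (\<lambda>w. 1 * w powi k)" for k
  proof -
    have "(\<lambda>N. (\<Sum>n=1..N. z n powi k) / of_nat N) \<longlonglongrightarrow> (if k = 0 then 1 else 0)"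
    proof (cases "k = 0")
      case True
      have "\<forall>\<^sub>F N in sequentially. (1::complex) = (\<Sum>n=1..N. z n powi k) / of_nat N"
        using eventually_gt_at_top[of 0] by eventually_elim (use True in auto)
      then show ?thesis
        using True by (auto intro: Lim_transform_eventually)
    qed (use weyl in auto)
    moreover have "continuous_on (sphere 0 1) (\<lambda>w::complex. w powi k)"
      by (intro continuous_intros) auto
    ultimately show ?thesis
      by (simp only: averages_to_integral_def integral_character mult_1 simp_thms)
  qed
  have poly: "?A f \<longlonglongrightarrow> ?I f" if f: "real_polynomial_function f" for f
  proof -
    have "averages_to_integral z (\<lambda>w. of_real (f w))"
      using averages_to_integral_polynomial_mult[OF f z chars, of 0] by simp
    then have lim: "(\<lambda>N. (\<Sum>n=1..N. of_real (f (z n))) / of_nat N) \<longlonglongrightarrow>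
        integral {0..1} (\<lambda>t. complex_of_real (f (cis (2 * pi * t))))"
      and "continuous_on (sphere 0 1) (\<lambda>w. complex_of_real (f w))"
      by (auto simp: averages_to_integral_def)
    then have "(\<lambda>t. complex_of_real (f (cis (2 * pi * t)))) integrable_on {0..1}"
      by (intro integrable_on_circle)
    then have "Re (integral {0..1} (\<lambda>t. complex_of_real (f (cis (2 * pi * t))))) = ?I f"
      using integral_linear[OF _ bounded_linear_Re, of "\<lambda>t. complex_of_real (f (cis (2 * pi * t)))"]
      by (simp add: o_def)
    with tendsto_Re[OF lim] show ?thesis
      by simp
  qed
  show ?thesis
  proof (rule metric_LIMSEQ_I)
    fix e :: real assume e: "e > 0"
    obtain f where f: "real_polynomial_function f" and Ff: "\<And>w. w \<in> sphere 0 1 \<Longrightarrow> \<bar>F w - f w\<bar> < e / 3"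
      using Stone_Weierstrass_real_polynomial_function[OF _ F, of "e / 3"] e by auto
    have contf: "continuous_on (sphere 0 1) f"
      using continuous_real_polymonial_function[OF f]
      by (simp add: continuous_at_imp_continuous_on)
    have "continuous_on {0..1} (\<lambda>t. F (cis (2 * pi * t)) - f (cis (2 * pi * t)))"
      by (rule continuous_on_compose2[OF continuous_on_diff[OF F contf]])
         (auto intro!: continuous_intros)
    moreover have "norm (F (cis (2 * pi * t)) - f (cis (2 * pi * t))) \<le> e / 3" for t
      using Ff[of "cis (2 * pi * t)"] by simp
    ultimately have "norm (integral {0..1} (\<lambda>t. F (cis (2 * pi * t)) - f (cis (2 * pi * t)))) \<le> e / 3 * (1 - 0)"
      by (intro integral_bound) auto
    moreover have "integral {0..1} (\<lambda>t. F (cis (2 * pi * t)) - f (cis (2 * pi * t))) = ?I F - ?I f"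
      by (intro integral_diff integrable_on_circle F contf)
    ultimately have I: "\<bar>?I F - ?I f\<bar> \<le> e / 3"
      by simp
    have A: "\<bar>?A F N - ?A f N\<bar> \<le> e / 3" for N
    proof (cases "N = 0")
      case False
      have "\<bar>(\<Sum>n=1..N. F (z n)) - (\<Sum>n=1..N. f (z n))\<bar> \<le> (\<Sum>n=1..N. \<bar>F (z n) - f (z n)\<bar>)"
        by (simp flip: sum_subtractf)
      also have "\<dots> \<le> (\<Sum>n=1..N. e / 3)"
        using Ff z by (intro sum_mono) (auto intro!: less_imp_le)
      also have "\<dots> = N * (e / 3)" by simp
      finally have "\<bar>(\<Sum>n=1..N. F (z n)) - (\<Sum>n=1..N. f (z n))\<bar> / N \<le> e / 3"
        using False by (simp add: field_simps)
      then show ?thesis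
        by (simp flip: diff_divide_distrib)
    qed (use e in simp)
    obtain N0 where "\<And>N. N \<ge> N0 \<Longrightarrow> dist (?A f N) (?I f) < e / 3"
      using metric_LIMSEQ_D[OF poly[OF f], of "e / 3"] e by auto
    then have f_close: "\<bar>?A f N - ?I f\<bar> < e / 3" if "N \<ge> N0" for N
      using that by (simp add: dist_real_def)
    have "dist (?A F N) (?I F) < e" if "N \<ge> N0" for N
      using I A[of N] f_close[OF that] unfolding dist_real_def by linarith
    then show "\<exists>N0. \<forall>N\<ge>N0. dist (?A F N) (?I F) < e" by blast
  qed
qed

text \<open>
  The indicator of the image of \<open>C\<close> on the circle is the decreasing limit of the tent functions
  \<open>F j\<close>. Winding \<open>{0..1}\<close> onto the circle identifies \<open>0\<close> with \<open>1\<close> only, which the integral does not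
  see.
\<close>

lemma proportion_in_compact_le:
  fixes x :: "nat \<Rightarrow> real" and C :: "real set"
  assumes weyl: "\<And>k::int. k \<noteq> 0 \<Longrightarrow> (\<lambda>N. (\<Sum>n=1..N. cis (2 * pi * (k * x n))) / of_nat N) \<longlonglongrightarrow> 0"
    and C: "compact C" "C \<noteq> {}" "C \<subseteq> {0..1}" and e: "e > 0"
  shows "\<forall>\<^sub>F N in sequentially. real (card {n \<in> {1..N}. frac (x n) \<in> C}) / real N < measure lborel C + e"
proof -
  define z where "z n = cis (2 * pi * x n)" for n
  define A where "A = (\<lambda>t. cis (2 * pi * t)) ` C"
  define F where "F j w = max 0 (1 - real j * infdist w A)" for j w
  have "compact A"
    unfolding A_def using C by (intro compact_continuous_image continuous_intros) auto
  then have A: "closed A" "A \<noteq> {}"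
    using C by (auto simp: A_def compact_imp_closed)
  have contF: "continuous_on S (F j)" for j S
    unfolding F_def by (intro continuous_intros)
  have F_bounds: "0 \<le> F j w" "F j w \<le> 1" for j w
    by (auto simp: F_def infdist_nonneg)
  have z_in: "z n \<in> A" if "frac (x n) \<in> C" for n
  proof -
    have "z n = cis (2 * pi * frac (x n))"
      by (simp add: z_def frac_def right_diff_distrib flip: cis_divide)
    with that show ?thesis by (auto simp: A_def)
  qed
  have "(\<lambda>j. integral {0..1} (\<lambda>t. F j (cis (2 * pi * t)))) \<longlonglongrightarrow>
      integral {0..1} (\<lambda>t. indicat_real A (cis (2 * pi * t)))"
  proof (rule dominated_convergence(2)[where h = "\<lambda>_. 1"])
    fix t :: real
    define w where "w = cis (2 * pi * t)"
    show "(\<lambda>j. F j (cis (2 * pi * t))) \<longlonglongrightarrow> indicat_real A (cis (2 * pi * t))"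
    proof (cases "w \<in> A")
      case False
      then have "infdist w A > 0"
        using A by (metis in_closed_iff_infdist_zero infdist_nonneg less_eq_real_def)
      then obtain j0 where "1 / infdist w A < real j0"
        using reals_Archimedean2 by blast
      then have zero: "F j w = 0" if "j \<ge> j0" for j
        using that \<open>infdist w A > 0\<close> unfolding F_def
        by (smt (verit) divide_less_eq mult_right_mono of_nat_mono)
      have "\<forall>\<^sub>F j in sequentially. 0 = F j w"
        using eventually_ge_at_top[of j0] by eventually_elim (simp add: zero)
      with False show ?thesis
        by (auto simp flip: w_def intro: Lim_transform_eventually)
    qed (simp add: F_def flip: w_def)
  qed (use F_bounds in \<open>auto intro!: integrable_on_circle contF\<close>)
  also have "integral {0..1} (\<lambda>t. indicat_real A (cis (2 * pi * t))) = integral {0..1} (indicat_real C)"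
  proof (rule integral_spike[where S = "{0, 1}"])
    \<comment> \<open>Two points of the closed unit interval with the same image differ by an integer, which vanishes as one of them is interior.\<close>
    fix t :: real assume t: "t \<in> {0..1} - {0, 1}"
    have "t \<in> C" if eq: "cis (2 * pi * t) = cis (2 * pi * s)" and "s \<in> C" for s
    proof -
      obtain k :: int where "2 * pi * t = 2 * pi * s + 2 * pi * k"
        using sin_cos_eq_iff[of "2 * pi * t" "2 * pi * s"]
          arg_cong[OF eq, of Re] arg_cong[OF eq, of Im] by auto
      then have "2 * pi * (t - s - k) = 0"
        by (simp add: algebra_simps)
      then have k: "t - s = k" by simp
      moreover have "-1 < t - s" "t - s < 1"
        using t that C by auto
      ultimately have "k = 0" by linarith
      with k that show ?thesis by simp
    qed
    then show "indicat_real C t = indicat_real A (cis (2 * pi * t))"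
      by (auto simp: A_def indicator_def)
  qed auto
  also have "\<dots> = measure lborel C"
    using C by (subst integral_indicator) (auto simp: Int_absorb1 Int_absorb2 lmeasurable_compact
        measure_completion compact_imp_closed borel_closed)
  finally obtain j where j: "integral {0..1} (\<lambda>t. F j (cis (2 * pi * t))) < measure lborel C + e"
    using e by (metis (no_types, lifting) eventually_sequentially less_add_same_cancel1 order_refl order_tendstoD(2))
  have "(\<lambda>N. (\<Sum>n=1..N. F j (z n)) / real N) \<longlonglongrightarrow> integral {0..1} (\<lambda>t. F j (cis (2 * pi * t)))"
  proof (rule averages_of_continuous)
    fix k :: int assume "k \<noteq> 0"
    then show "(\<lambda>N. (\<Sum>n=1..N. z n powi k) / of_nat N) \<longlonglongrightarrow> 0"
      using weyl[of k] by (simp add: z_def cis_power_int mult_ac)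
  qed (auto simp: z_def intro: contF)
  then have "\<forall>\<^sub>F N in sequentially. (\<Sum>n=1..N. F j (z n)) / real N < measure lborel C + e"
    using j by (rule order_tendstoD)
  then show ?thesis
  proof eventually_elim
    fix N
    assume less: "(\<Sum>n=1..N. F j (z n)) / real N < measure lborel C + e"
    have "real (card {n \<in> {1..N}. frac (x n) \<in> C}) = (\<Sum>n \<in> {n \<in> {1..N}. frac (x n) \<in> C}. F j (z n))"
      using z_in A by (simp add: F_def)
    also have "\<dots> \<le> (\<Sum>n=1..N. F j (z n))"
      by (intro sum_mono2) (auto simp: F_def)
    finally have "real (card {n \<in> {1..N}. frac (x n) \<in> C}) / real N \<le> (\<Sum>n=1..N. F j (z n)) / real N"
      by (intro divide_right_mono) auto
    with less show "real (card {n \<in> {1..N}. frac (x n) \<in> C}) / real N < measure lborel C + e"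
      by linarith
  qed
qed

text \<open>
  Upper bounds on closed sets are enough: an upper bound for the complement of an interval is a
  lower bound for the interval.
\<close>

lemma weyl_criterion:
  fixes x :: "nat \<Rightarrow> real"
  assumes weyl: "\<And>k::int. k \<noteq> 0 \<Longrightarrow> (\<lambda>N. (\<Sum>n=1..N. cis (2 * pi * (k * x n))) / of_nat N) \<longlonglongrightarrow> 0"
  shows "equidistributed_mod_1 x"
  unfolding equidistributed_mod_1_def
proof (intro allI impI, elim conjE)
  fix I :: "real set" assume I: "is_interval I" "I \<subseteq> {0..1}"
  let ?r = "\<lambda>J N. real (card {n \<in> {1..N}. frac (x n) \<in> J}) / real N"
  show "?r I \<longlonglongrightarrow> measure lborel I"
  proof (cases "I = {}")
    case False
    define a b where "a = Inf I" and "b = Sup I"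
    have bdd: "bdd_below I" "bdd_above I"
      using I by (auto intro: bdd_below_mono bdd_above_mono)
    have I_ab: "I \<subseteq> {a..b}"
      using bdd by (auto simp: a_def b_def intro: cInf_lower cSup_upper)
    have ab_I: "{a<..<b} \<subseteq> I"
    proof
      fix t assume t: "t \<in> {a<..<b}"
      obtain u v where "u \<in> I" "u < t" "v \<in> I" "t < v"
        using t False bdd by (auto simp: a_def b_def cInf_less_iff less_cSup_iff)
      then show "t \<in> I"
        using I(1) by (meson is_interval_1 less_imp_le)
    qed
    have ab: "0 \<le> a" "a \<le> b" "b \<le> 1"
      using False I by (auto simp: a_def b_def intro!: cInf_greatest cSup_least cInf_le_cSup bdd)
    have meas: "measure lborel I = b - a"
    proof (rule antisym)
      have [measurable]: "I \<in> sets borel"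
        using I(1) by (rule real_interval_borel_measurable)
      have fin: "emeasure lborel I \<noteq> \<infinity>" "emeasure lborel {a..b} \<noteq> \<infinity>"
        using I_ab emeasure_mono[of I "{a..b}" lborel] ab by (auto simp: top_unique)
      then have fm: "I \<in> fmeasurable lborel" "{a..b} \<in> fmeasurable lborel"
        by (auto simp: fmeasurable_def less_top)
      show "measure lborel I \<le> b - a"
        using measure_mono_fmeasurable[OF I_ab _ fm(2)] ab by auto
      show "b - a \<le> measure lborel I"
        using measure_mono_fmeasurable[OF ab_I _ fm(1)] ab by auto
    qed
    \<comment> \<open>The complement is covered by two closed intervals of total length
      \<open>1 - (b - a)\<close>, so its upper bound is a lower bound for the interval itself.\<close>
    define C where "C = {0..a} \<union> {b..1}"
    have C: "compact C" "C \<noteq> {}" "C \<subseteq> {0..1}"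
      using ab by (auto simp: C_def)
    have meas_C: "measure lborel C \<le> 1 - (b - a)"
      using measure_Un_le[of "{0..a}" lborel "{b..1}"] ab by (auto simp: C_def)
    have cover: "1 - ?r C N \<le> ?r I N" if "N \<ge> 1" for N
    proof -
      have "{1..N} \<subseteq> {n \<in> {1..N}. frac (x n) \<in> I} \<union> {n \<in> {1..N}. frac (x n) \<in> C}"
      proof
        fix n assume n: "n \<in> {1..N}"
        have "0 \<le> frac (x n)" "frac (x n) \<le> 1"
          using frac_lt_1[of "x n"] by auto
        then have "frac (x n) \<in> {a<..<b} \<union> C"
          by (auto simp: C_def)
        with n ab_I show "n \<in> {n \<in> {1..N}. frac (x n) \<in> I} \<union> {n \<in> {1..N}. frac (x n) \<in> C}"
          by auto
      qed
      from card_mono[OF _ this]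
      have "N \<le> card ({n \<in> {1..N}. frac (x n) \<in> I} \<union> {n \<in> {1..N}. frac (x n) \<in> C})"
        by simp
      also have "\<dots> \<le> card {n \<in> {1..N}. frac (x n) \<in> I} + card {n \<in> {1..N}. frac (x n) \<in> C}"
        by (rule card_Un_le)
      finally have "real N \<le> real (card {n \<in> {1..N}. frac (x n) \<in> I}) + real (card {n \<in> {1..N}. frac (x n) \<in> C})"
        by linarith
      then have "real N / N \<le> (real (card {n \<in> {1..N}. frac (x n) \<in> I}) + real (card {n \<in> {1..N}. frac (x n) \<in> C})) / N"
        by (rule divide_right_mono) simp
      with that show ?thesis by (simp add: add_divide_distrib)
    qed
    show ?thesis
    proof (rule order_tendstoI)
      fix y assume "y < measure lborel I"
      then have "\<forall>\<^sub>F N in sequentially. ?r C N < measure lborel C + (b - a - y)"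
        by (intro proportion_in_compact_le weyl C) (auto simp: meas)
      then show "\<forall>\<^sub>F N in sequentially. y < ?r I N"
        using eventually_ge_at_top[of 1]
      proof eventually_elim
        case (elim N)
        with cover[of N] meas_C show ?case by linarith
      qed
    next
      fix y assume "measure lborel I < y"
      then have "\<forall>\<^sub>F N in sequentially. ?r {a..b} N < measure lborel {a..b} + (y - (b - a))"
        using ab by (intro proportion_in_compact_le weyl) (auto simp: meas)
      then show "\<forall>\<^sub>F N in sequentially. ?r I N < y"
      proof eventually_elim
        case (elim N)
        have "?r I N \<le> ?r {a..b} N"
          using I_ab by (intro divide_right_mono of_nat_mono card_mono) auto
        with elim ab show ?case by simp
      qed
    qed
  qed simp
qed

section \<open>Averages of weakly correlated functions\<close>

text \<open>
  The ratio of consecutive \<open>P\<close>-th powers tends to \<open>1\<close>, so the terms between two of them change a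
  bounded average by a vanishing amount.
\<close>

lemma averages_tendsto_0_from_powers:
  fixes a :: "nat \<Rightarrow> complex"
  assumes a: "\<And>n. norm (a n) \<le> 1" and P: "P \<ge> 1"
    and lim: "(\<lambda>k. (\<Sum>n=1..k ^ P. a n) / of_nat (k ^ P)) \<longlonglongrightarrow> 0"
  shows "(\<lambda>N. (\<Sum>n=1..N. a n) / of_nat N) \<longlonglongrightarrow> 0"
proof -
  \<comment> \<open>The last \<open>P\<close>-th power not exceeding \<open>N\<close> is \<open>k N ^ P\<close>.\<close>
  define k where "k N = nat \<lfloor>root P (real N)\<rfloor>" for N
  define S where "S N = (\<Sum>n=1..N. a n)" for N
  have k_le: "k N ^ P \<le> N" for N
  proof -
    have "real (k N) \<le> root P (real N)"
      unfolding k_def by (intro of_nat_floor real_root_ge_zero) simp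
    then have "real (k N) ^ P \<le> root P (real N) ^ P"
      by (intro power_mono) auto
    then have "real (k N ^ P) \<le> real N"
      using P by (simp add: real_root_pow_pos2)
    then show ?thesis by linarith
  qed
  have k_gt: "N < Suc (k N) ^ P" for N
  proof -
    have "root P (real N) < real (Suc (k N))"
      by (simp add: k_def) linarith
    then have "root P (real N) ^ P < real (Suc (k N)) ^ P"
      using P by (intro power_strict_mono) auto
    then have "real N < real (Suc (k N) ^ P)"
      using P by (simp add: real_root_pow_pos2)
    then show ?thesis by linarith
  qed
  have "filterlim k at_top at_top"
    unfolding filterlim_at_top
  proof
    fix Z
    have "Z \<le> k N" if "N \<ge> Z ^ P" for N
    proof -
      have "Z ^ P < Suc (k N) ^ P"
        using that k_gt[of N] by linarith
      then have "Z < Suc (k N)"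
        by (rule power_less_imp_less_base) simp
      then show ?thesis by simp
    qed
    then show "\<forall>\<^sub>F N in sequentially. Z \<le> k N"
      by (auto simp: eventually_sequentially)
  qed
  note k_lim = this
  have "(\<lambda>j. norm (S (j ^ P) / of_nat (j ^ P)) + ((1 + 1 / real j) ^ P - 1)) \<longlonglongrightarrow> 0 + ((1 + 0) ^ P - 1)"
    by (intro tendsto_add tendsto_diff tendsto_power tendsto_const lim_1_over_n
        tendsto_norm_zero lim[folded S_def])
  from filterlim_compose[OF this k_lim]
  have bound: "(\<lambda>N. norm (S (k N ^ P) / of_nat (k N ^ P)) + ((1 + 1 / real (k N)) ^ P - 1)) \<longlonglongrightarrow> 0"
    by simp
  have "(\<lambda>N. S N / of_nat N) \<longlonglongrightarrow> 0"
  proof (rule Lim_null_comparison[OF _ bound])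
    have "\<forall>\<^sub>F N in sequentially. k N \<ge> 1"
      using k_lim by (auto simp: filterlim_at_top)
    then show "\<forall>\<^sub>F N in sequentially.
        norm (S N / of_nat N) \<le> norm (S (k N ^ P) / of_nat (k N ^ P)) + ((1 + 1 / real (k N)) ^ P - 1)"
    proof eventually_elim
      fix N assume k1: "1 \<le> k N"
      define K where "K = k N ^ P"
      have K: "K \<ge> 1" "K \<le> N" "N < Suc (k N) ^ P"
        using k1 k_le[of N] k_gt[of N] by (auto simp: K_def)
      have "S N = S K + (\<Sum>n\<in>{K<..N}. a n)"
        unfolding S_def using K
        by (subst sum.union_disjoint[symmetric]) (auto intro!: sum.cong)
      moreover have "norm (\<Sum>n\<in>{K<..N}. a n) \<le> real (card {K<..N}) * 1"
        using a by (intro sum_norm_bound) auto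
      ultimately have "norm (S N) \<le> norm (S K) + real (N - K)"
        using norm_triangle_ineq[of "S K" "\<Sum>n\<in>{K<..N}. a n"] by simp
      then have "norm (S N) / N \<le> (norm (S K) + real (N - K)) / N"
        by (intro divide_right_mono) auto
      also have "\<dots> \<le> (norm (S K) + real (N - K)) / K"
        using K by (intro divide_left_mono) auto
      also have "\<dots> = norm (S K) / K + (real N / K - 1)"
        using K by (simp add: field_simps of_nat_diff)
      also have "real N / K \<le> real (Suc (k N) ^ P) / K"
        using K by (intro divide_right_mono) (auto simp del: of_nat_Suc of_nat_power)
      also have "real (Suc (k N) ^ P) / K = (1 + 1 / real (k N)) ^ P"
        using k1 by (simp add: K_def add_divide_distrib add.commute flip: power_divide)
      finally show "norm (S N / of_nat N) \<le> norm (S (k N ^ P) / of_nat (k N ^ P)) + ((1 + 1 / real (k N)) ^ P - 1)"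
        by (simp add: norm_divide flip: K_def)
    qed
  qed
  then show ?thesis by (simp add: S_def)
qed

context prob_space begin

text \<open>
  Expand the square into correlations. At most \<open>2 D\<close> indices lie at distance less than \<open>D\<close> from a given one,
  and their correlations are at most \<open>1\<close>; all others are at most \<open>C D powr - \<tau>\<close>.
\<close>

lemma second_moment_of_sum_le:
  fixes f :: "nat \<Rightarrow> 'a \<Rightarrow> complex"
  assumes [measurable]: "\<And>n. f n \<in> borel_measurable M" and f: "\<And>n x. norm (f n x) \<le> 1"
    and C: "C \<ge> 0" and \<tau>: "\<tau> > 0"
    and corr: "\<And>n k. 1 \<le> k \<Longrightarrow> k < n \<Longrightarrow>
      norm (\<integral>x. f n x * cnj (f k x) \<partial>M) \<le> C * real (n - k) powr - \<tau>"
    and D: "D \<ge> 1"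
  shows "(\<integral>x. (norm (\<Sum>n=1..N. f n x))\<^sup>2 \<partial>M) \<le> 2 * real D * real N + C * real D powr - \<tau> * (real N)\<^sup>2"
proof -
  have [measurable]: "(\<lambda>x. cnj (f n x)) \<in> borel_measurable M" for n
    by (rule borel_measurable_continuous_on[where f = cnj]) (auto intro!: continuous_intros)
  have int: "integrable M (\<lambda>x. f n x * cnj (f k x))" for n k
    using f by (intro integrable_const_bound[where B = 1])
      (auto simp: norm_mult intro!: AE_I2 mult_le_one)
  define E where "E n k = (\<integral>x. f n x * cnj (f k x) \<partial>M)" for n k
  have E_1: "norm (E n k) \<le> 1" for n k
  proof -
    have "norm (E n k) \<le> (\<integral>x. norm (f n x * cnj (f k x)) \<partial>M)"
      unfolding E_def by (rule integral_norm_bound)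
    also have "\<dots> \<le> (\<integral>x. 1 \<partial>M)"
      using f int by (intro integral_mono integrable_norm) (auto simp: norm_mult intro!: mult_le_one)
    finally show ?thesis by (simp add: prob_space)
  qed
  have E_sym: "norm (E k n) = norm (E n k)" for n k
  proof -
    have "E k n = (\<integral>x. cnj (f n x * cnj (f k x)) \<partial>M)"
      unfolding E_def by (simp add: mult.commute)
    then show ?thesis
      using Bochner_Integration.integral_cnj[of M "\<lambda>x. f n x * cnj (f k x)"] unfolding E_def by (metis complex_mod_cnj)
  qed
  have far: "norm (E n k) \<le> C * real D powr - \<tau>" if "1 \<le> k" "k + D \<le> n" for n k
  proof -
    have "norm (E n k) \<le> C * real (n - k) powr - \<tau>"
      using corr[of k n] that D by (auto simp: E_def)
    also have "\<dots> \<le> C * real D powr - \<tau>"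
      using that D \<tau> C by (intro mult_left_mono powr_mono2') auto
    finally show ?thesis .
  qed
  have pair: "norm (E n k) \<le> (if k \<in> {Suc n - D..<n + D} then 1 else 0) + C * real D powr - \<tau>"
    if "1 \<le> n" "1 \<le> k" for n k
  proof (cases "k \<in> {Suc n - D..<n + D}")
    case True
    with E_1[of n k] C show ?thesis by (simp add: add_increasing2)
  next
    case False
    then have "k + D \<le> n \<or> n + D \<le> k" by auto
    with far[of k n] far[of n k] E_sym[of n k] that False show ?thesis by auto
  qed
  have row: "(\<Sum>k=1..N. norm (E n k)) \<le> 2 * real D + real N * (C * real D powr - \<tau>)" if "1 \<le> n" for n
  proof -
    have "(\<Sum>k=1..N. norm (E n k)) \<le>
        (\<Sum>k=1..N. (if k \<in> {Suc n - D..<n + D} then 1 else 0) + C * real D powr - \<tau>)"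
      using pair that by (intro sum_mono) auto
    also have "\<dots> = real (card ({1..N} \<inter> {Suc n - D..<n + D})) + N * (C * real D powr - \<tau>)"
      by (subst sum.distrib, subst sum.inter_restrict[symmetric]) auto
    also have "card ({1..N} \<inter> {Suc n - D..<n + D}) \<le> card {Suc n - D..<n + D}"
      by (intro card_mono) auto
    also have "\<dots> \<le> 2 * D" by simp
    finally show ?thesis by simp
  qed
  have "complex_of_real (\<integral>x. (norm (\<Sum>n=1..N. f n x))\<^sup>2 \<partial>M)
      = (\<integral>x. complex_of_real ((norm (\<Sum>n=1..N. f n x))\<^sup>2) \<partial>M)"
    by (rule integral_complex_of_real[symmetric])
  also have "\<dots> = (\<integral>x. (\<Sum>n=1..N. \<Sum>k=1..N. f n x * cnj (f k x)) \<partial>M)"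
    by (intro Bochner_Integration.integral_cong refl)
       (simp only: complex_norm_square sum_product cnj_sum)
  also have "\<dots> = (\<Sum>n=1..N. \<Sum>k=1..N. E n k)"
    unfolding E_def using int by (simp add: Bochner_Integration.integral_sum)
  finally have "norm (complex_of_real (\<integral>x. (norm (\<Sum>n=1..N. f n x))\<^sup>2 \<partial>M)) = norm (\<Sum>n=1..N. \<Sum>k=1..N. E n k)"
    by (rule arg_cong)
  then have "(\<integral>x. (norm (\<Sum>n=1..N. f n x))\<^sup>2 \<partial>M) = norm (\<Sum>n=1..N. \<Sum>k=1..N. E n k)"
    by (simp only: norm_of_real) (simp add: integral_nonneg)
  also have "\<dots> \<le> (\<Sum>n=1..N. \<Sum>k=1..N. norm (E n k))"
    by (intro sum_norm_le order_refl)
  also have "\<dots> \<le> (\<Sum>n=1..N. 2 * real D + real N * (C * real D powr - \<tau>))"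
    using row by (intro sum_mono) auto
  also have "\<dots> = 2 * real D * real N + C * real D powr - \<tau> * (real N)\<^sup>2"
    by (simp add: algebra_simps power2_eq_square)
  finally show ?thesis .
qed

text \<open>
  With \<open>N = k\<^sup>2\<^sup>L\<close> and the cut \<open>D = k\<^sup>L\<close> the second moment of the average is at most a constant times
  \<open>k\<^sup>-\<^sup>2\<close> once \<open>L \<ge> 2\<close> and \<open>L \<tau> \<ge> 2\<close>. These bounds are summable, so the averages tend to \<open>0\<close>
  almost surely along this sequence of \<open>N\<close>.
\<close>

lemma averages_tendsto_0_AE:
  fixes f :: "nat \<Rightarrow> 'a \<Rightarrow> complex"
  assumes [measurable]: "\<And>n. f n \<in> borel_measurable M" and f: "\<And>n x. norm (f n x) \<le> 1"
    and C: "C \<ge> 0" and \<tau>: "\<tau> > 0"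
    and corr: "\<And>n k. 1 \<le> k \<Longrightarrow> k < n \<Longrightarrow>
      norm (\<integral>x. f n x * cnj (f k x) \<partial>M) \<le> C * real (n - k) powr - \<tau>"
  shows "AE x in M. (\<lambda>N. (\<Sum>n=1..N. f n x) / of_nat N) \<longlonglongrightarrow> 0"
proof -
  define L where "L = max 2 (nat \<lceil>2 / \<tau>\<rceil>)"
  have L: "L \<ge> 2" "L * \<tau> \<ge> 2"
  proof -
    have "2 / \<tau> \<le> L" unfolding L_def by linarith
    then show "L * \<tau> \<ge> 2" using \<tau> by (simp add: field_simps)
  qed (simp add: L_def)
  define a where "a k x = (norm ((\<Sum>n=1..k ^ (2 * L). f n x) / of_nat (k ^ (2 * L))))\<^sup>2" for k x
  have a_nonneg: "a k x \<ge> 0" for k x by (simp add: a_def)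
  have [measurable]: "a k \<in> borel_measurable M" for k
    unfolding a_def by measurable
  have a_le: "a k x \<le> 1" for k x
  proof -
    have "norm (\<Sum>n=1..k ^ (2 * L). f n x) \<le> real (card {1..k ^ (2 * L)}) * 1"
      using f by (intro sum_norm_bound) auto
    then have "norm ((\<Sum>n=1..k ^ (2 * L). f n x) / of_nat (k ^ (2 * L))) \<le> 1"
      by (auto simp: norm_divide norm_power divide_le_eq_1)
    then show ?thesis
      unfolding a_def by (intro power_le_one) auto
  qed
  have a_int: "integrable M (a k)" for k
    using a_le a_nonneg by (intro integrable_const_bound[where B = 1]) auto
  have moment: "(\<integral>x. a k x \<partial>M) \<le> (2 + C) * (1 / real k ^ 2)" if k: "k \<ge> 1" for k
  proof -
    define D where "D = k ^ L"
    have D: "D \<ge> 1" using k by (simp add: D_def)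
    have N: "k ^ (2 * L) = D\<^sup>2" by (simp add: D_def mult.commute flip: power_mult)
    have "(\<integral>x. a k x \<partial>M) = (\<integral>x. (norm (\<Sum>n=1..D\<^sup>2. f n x))\<^sup>2 / real D ^ 4 \<partial>M)"
      unfolding a_def N by (simp add: norm_divide norm_power power_divide flip: power_mult)
    also have "\<dots> = (\<integral>x. (norm (\<Sum>n=1..D\<^sup>2. f n x))\<^sup>2 \<partial>M) / real D ^ 4"
      by simp
    also have "\<dots> \<le> (2 * real D * real (D\<^sup>2) + C * real D powr - \<tau> * (real (D\<^sup>2))\<^sup>2) / real D ^ 4"
      using second_moment_of_sum_le[OF assms(1) f C \<tau> corr D, of "D\<^sup>2"]
      by (intro divide_right_mono) auto
    also have "\<dots> = 2 * (1 / D) + C * real D powr - \<tau>"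
      using D by (simp add: field_simps power2_eq_square power4_eq_xxxx)
    finally have le: "(\<integral>x. a k x \<partial>M) \<le> 2 * (1 / real D) + C * real D powr - \<tau>" .
    have "1 / real D \<le> 1 / real k ^ 2"
      using k L unfolding D_def by (intro divide_left_mono) (auto intro!: power_increasing)
    moreover have "real D powr - \<tau> = real k powr - (L * \<tau>)"
      using k by (simp add: D_def powr_powr flip: powr_realpow)
    moreover have "real k powr - (L * \<tau>) \<le> real k powr - 2"
      using k L by (intro powr_mono) auto
    moreover have "real k powr - 2 = 1 / real k ^ 2"
      using k by (simp add: powr_minus_divide)
    ultimately have "real D powr - \<tau> \<le> 1 / real k ^ 2" "2 * (1 / real D) \<le> 2 * (1 / real k ^ 2)"
      by auto
    with mult_left_mono[OF this(1) C] le show ?thesis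
      by (simp only: distrib_right)
  qed
  have "(\<Sum>k. \<integral>\<^sup>+x. ennreal (a (Suc k) x) \<partial>M) \<le> (\<Sum>k. ennreal ((2 + C) * (1 / real (Suc k) ^ 2)))"
    using moment a_nonneg a_int
    by (intro suminf_le) (auto simp: nn_integral_eq_integral intro!: ennreal_leI simp del: of_nat_Suc)
  also have "\<dots> < \<top>"
  proof -
    have "summable (\<lambda>k. (2 + C) * (1 / real (Suc k) ^ 2))"
      using inverse_power_summable[of 2, where 'a = real]
      by (intro summable_mult) (subst summable_Suc_iff, simp add: divide_inverse)
    then show ?thesis
      using C by (subst suminf_ennreal2) auto
  qed
  finally have "(\<integral>\<^sup>+x. (\<Sum>k. ennreal (a (Suc k) x)) \<partial>M) \<noteq> \<infinity>"
    by (subst nn_integral_suminf) auto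
  then have "AE x in M. (\<Sum>k. ennreal (a (Suc k) x)) \<noteq> \<infinity>"
    by (intro nn_integral_noteq_infinite) auto
  then show ?thesis
  proof eventually_elim
    case (elim x)
    then have "summable (\<lambda>k. a (Suc k) x)"
      using a_nonneg by (intro summable_suminf_not_top) auto
    then have "(\<lambda>k. a (Suc k) x) \<longlonglongrightarrow> 0"
      by (rule summable_LIMSEQ_zero)
    then have "(\<lambda>k. sqrt (a k x)) \<longlonglongrightarrow> sqrt 0"
      by (intro tendsto_real_sqrt) (rule LIMSEQ_imp_Suc)
    then have "(\<lambda>k. (\<Sum>n=1..k ^ (2 * L). f n x) / of_nat (k ^ (2 * L))) \<longlonglongrightarrow> 0"
      unfolding a_def by (subst tendsto_norm_zero_iff[symmetric]) simp
    then show ?case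
      using f L by (intro averages_tendsto_0_from_powers[where P = "2 * L"]) auto
  qed
qed

end

section \<open>Integer sequences that follow an expanding map\<close>

text \<open>
  The labels \<open>\<kappa> 0 x, \<kappa> 1 x, \<dots>\<close> form a path in a tree in which a vertex \<open>i\<close> has children \<open>N i\<close>. The
  weight of a path depends on its labels only, and the weights of the children of a vertex add up
  to at most \<open>c\<close>; so each generation costs a factor \<open>c\<close>, and the mass of a single vertex of the last
  generation is at most \<open>B\<close>.
\<close>

lemma nn_integral_path_weights_le:
  fixes \<kappa> :: "nat \<Rightarrow> 'a \<Rightarrow> int" and H :: "int \<Rightarrow> int \<Rightarrow> ennreal"
  assumes [measurable]: "\<And>k. \<kappa> k \<in> measurable M (count_space UNIV)"
    and fin: "\<And>i. finite (N i)"
    and N: "\<And>k x. x \<in> space M \<Longrightarrow> \<kappa> (Suc k) x \<in> N (\<kappa> k x)"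
    and c: "\<And>i. (\<Sum>i'\<in>N i. H i i') \<le> c"
    and B: "\<And>i. emeasure M {x \<in> space M. \<kappa> (n + j) x = i} \<le> B"
  shows "(\<integral>\<^sup>+x. indicator {x \<in> space M. \<kappa> n x = i} x *
      (\<Prod>k<j. H (\<kappa> (n + k) x) (\<kappa> (n + Suc k) x)) \<partial>M) \<le> c ^ j * B"
  using B
proof (induction j arbitrary: n i)
  case 0
  then show ?case by simp
next
  case (Suc j)
  have [measurable]: "(\<lambda>x. H (\<kappa> a x) (\<kappa> b x)) \<in> borel_measurable M" for a b
    by (rule measurable_compose_countable[where f = "\<lambda>u x. H u (\<kappa> b x)" and g = "\<kappa> a"]) auto
  let ?w = "\<lambda>x. \<Prod>k<j. H (\<kappa> (Suc n + k) x) (\<kappa> (Suc n + Suc k) x)"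
  have "(\<integral>\<^sup>+x. indicator {x \<in> space M. \<kappa> n x = i} x *
        (\<Prod>k<Suc j. H (\<kappa> (n + k) x) (\<kappa> (n + Suc k) x)) \<partial>M)
      \<le> (\<integral>\<^sup>+x. (\<Sum>i'\<in>N i. H i i' * (indicator {x \<in> space M. \<kappa> (Suc n) x = i'} x * ?w x)) \<partial>M)"
  proof (rule nn_integral_mono)
    fix x assume x: "x \<in> space M"
    show "indicator {x \<in> space M. \<kappa> n x = i} x * (\<Prod>k<Suc j. H (\<kappa> (n + k) x) (\<kappa> (n + Suc k) x))
      \<le> (\<Sum>i'\<in>N i. H i i' * (indicator {x \<in> space M. \<kappa> (Suc n) x = i'} x * ?w x))"
    proof (cases "\<kappa> n x = i")
      case True
      then have mem: "\<kappa> (Suc n) x \<in> N i"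
        using N[OF x, of n] by simp
      have "indicator {x \<in> space M. \<kappa> n x = i} x * (\<Prod>k<Suc j. H (\<kappa> (n + k) x) (\<kappa> (n + Suc k) x))
          = H i (\<kappa> (Suc n) x) * (indicator {y \<in> space M. \<kappa> (Suc n) y = \<kappa> (Suc n) x} x * ?w x)"
        using x True by (subst prod.lessThan_Suc_shift) simp
      also have "\<dots> \<le> (\<Sum>i'\<in>N i. H i i' * (indicator {x \<in> space M. \<kappa> (Suc n) x = i'} x * ?w x))"
        using mem by (intro member_le_sum fin) auto
      finally show ?thesis .
    qed simp
  qed
  also have "\<dots> = (\<Sum>i'\<in>N i. H i i' * (\<integral>\<^sup>+x. indicator {x \<in> space M. \<kappa> (Suc n) x = i'} x * ?w x \<partial>M))"
    by (subst nn_integral_sum) (auto intro!: sum.cong nn_integral_cmult)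
  also have "\<dots> \<le> (\<Sum>i'\<in>N i. H i i' * (c ^ j * B))"
    using Suc.prems by (intro sum_mono mult_left_mono Suc.IH) auto
  also have "\<dots> \<le> c * (c ^ j * B)"
    by (subst sum_distrib_right[symmetric]) (intro mult_right_mono c, simp)
  finally show ?case by (simp add: mult.assoc)
qed

lemma card_int_ball_le:
  fixes t r :: real
  assumes "r \<ge> 0"
  shows "finite {i::int. \<bar>i - t\<bar> \<le> r}" "real (card {i::int. \<bar>i - t\<bar> \<le> r}) \<le> 2 * r + 1"
proof -
  have eq: "{i::int. \<bar>i - t\<bar> \<le> r} = {\<lceil>t - r\<rceil>..\<lfloor>t + r\<rfloor>}"
    by (auto simp: abs_le_iff ceiling_le_iff le_floor_iff)
  show "finite {i::int. \<bar>i - t\<bar> \<le> r}" by (simp add: eq)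
  have "real (card {i::int. \<bar>i - t\<bar> \<le> r}) = real (nat (\<lfloor>t + r\<rfloor> + 1 - \<lceil>t - r\<rceil>))"
    by (simp add: eq)
  also have "\<dots> \<le> 2 * r + 1"
    using assms by linarith
  finally show "real (card {i::int. \<bar>i - t\<bar> \<le> r}) \<le> 2 * r + 1" .
qed

text \<open>
  The price of passing from the integer \<open>i\<close> nearest to \<open>u\<close> to the integer \<open>i'\<close> nearest to \<open>\<theta> u\<close>: free
  when \<open>i'\<close> is the integer predicted by \<open>\<theta> i\<close>, and \<open>\<eta>\<close> otherwise.
\<close>

definition path_weight :: "real \<Rightarrow> real \<Rightarrow> int \<Rightarrow> int \<Rightarrow> real" where
  "path_weight \<theta> \<eta> i i' = (if \<bar>i' - \<theta> * i\<bar> < 1 / 2 then 1 else \<eta>)"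

text \<open>
  At most one integer is predicted, and at most \<open>2 + \<theta>\<close> integers are admissible.
\<close>

lemma sum_path_weight_le:
  assumes "\<theta> > 1" "\<eta> \<ge> 0"
  shows "(\<Sum>i' | \<bar>real_of_int i' - \<theta> * i\<bar> \<le> (1 + \<theta>) / 2. path_weight \<theta> \<eta> i i') \<le> 1 + (2 + \<theta>) * \<eta>"
proof -
  let ?N = "{i'::int. \<bar>i' - \<theta> * i\<bar> \<le> (1 + \<theta>) / 2}"
  let ?Z = "{i'::int. \<bar>i' - \<theta> * i\<bar> < 1 / 2}"
  have fin: "finite ?N" and card: "real (card ?N) \<le> 2 + \<theta>"
    using card_int_ball_le[of "(1 + \<theta>) / 2" "\<theta> * i"] assms by (auto simp: field_simps)
  have "card (?N \<inter> ?Z) \<le> 1"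
  proof (rule card_le_Suc0_iff_eq[THEN iffD2, folded One_nat_def])
    show "\<forall>a\<in>?N \<inter> ?Z. \<forall>b\<in>?N \<inter> ?Z. a = b"
    proof (intro ballI)
      fix a b assume "a \<in> ?N \<inter> ?Z" "b \<in> ?N \<inter> ?Z"
      then have "\<bar>a - \<theta> * i\<bar> < 1 / 2" "\<bar>b - \<theta> * i\<bar> < 1 / 2" by auto
      then have "\<bar>real_of_int a - real_of_int b\<bar> < 1" by linarith
      then show "a = b" by linarith
    qed
  qed (use fin in auto)
  have "(\<Sum>i'\<in>?N. path_weight \<theta> \<eta> i i') \<le> (\<Sum>i'\<in>?N. (if i' \<in> ?Z then 1 else 0) + \<eta>)"
    using assms by (intro sum_mono) (auto simp: path_weight_def)
  also have "\<dots> = real (card (?N \<inter> ?Z)) + card ?N * \<eta>"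
    using fin by (subst sum.distrib, subst sum.inter_restrict[symmetric]) auto
  also have "\<dots> \<le> 1 + (2 + \<theta>) * \<eta>"
    using card \<open>card (?N \<inter> ?Z) \<le> 1\<close> assms by (intro add_mono mult_right_mono) auto
  finally show ?thesis .
qed

lemma round_expanding_step:
  fixes \<theta> u :: real
  assumes "\<theta> > 1"
  shows "\<bar>real_of_int (round (\<theta> * u)) - \<theta> * round u\<bar>
      \<le> \<bar>\<theta> * u - round (\<theta> * u)\<bar> + \<theta> * \<bar>u - round u\<bar>"
proof -
  have "real_of_int (round (\<theta> * u)) - \<theta> * round u
      = - (\<theta> * u - round (\<theta> * u)) + \<theta> * (u - round u)"
    by (simp add: algebra_simps)
  also have "\<bar>\<dots>\<bar> \<le> \<bar>\<theta> * u - round (\<theta> * u)\<bar> + \<bar>\<theta> * (u - round u)\<bar>"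
    by linarith
  finally show ?thesis
    using assms by (simp add: abs_mult)
qed

text \<open>
  If \<open>u\<close> and \<open>\<theta> u\<close> are both closer than \<open>\<delta>\<close> to integers, then \<open>\<delta> (1 + \<theta>) < 1 / 2\<close> forces the second
  integer to be the predicted one. So an unpredicted step has a far point at one of its two ends,
  where \<open>g \<le> \<eta>\<close>. The factors are squared because each level belongs to two steps and must be
  charged to both. The count \<open>2 r + 2\<close> bounds the possible integers at level \<open>0\<close>.
\<close>

lemma erdos_kahane_integral:
  fixes X :: "'a \<Rightarrow> real" and g :: "real \<Rightarrow> real" and \<theta> \<delta> \<eta> r B :: real
  assumes [measurable]: "X \<in> borel_measurable M"
    and \<theta>: "\<theta> > 1" and \<delta>: "\<delta> * (1 + \<theta>) < 1 / 2" and \<eta>: "\<eta> \<ge> 0"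
    and g01: "\<And>u. 0 \<le> g u" "\<And>u. g u \<le> 1"
    and g_far: "\<And>u::real. \<bar>u - round u\<bar> \<ge> \<delta> \<Longrightarrow> g u \<le> \<eta>"
    and X: "AE x in M. \<bar>X x\<bar> \<le> r" and r: "r \<ge> 0" and B0: "B \<ge> 0"
    and B: "\<And>i. emeasure M {x \<in> space M. round (\<theta> ^ l * X x) = i} \<le> ennreal B"
  shows "(\<integral>\<^sup>+x. ennreal (\<Prod>k\<le>l. (g (\<theta> ^ k * X x))\<^sup>2) \<partial>M)
      \<le> ennreal ((2 * r + 2) * (1 + (2 + \<theta>) * \<eta>) ^ l * B)"
proof -
  define \<kappa> where "\<kappa> k x = round (\<theta> ^ k * X x)" for k x
  define N where "N i = {i'::int. \<bar>i' - \<theta> * i\<bar> \<le> (1 + \<theta>) / 2}" for i :: int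
  define H where "H i i' = ennreal (path_weight \<theta> \<eta> i i')" for i i'
  define c where "c = 1 + (2 + \<theta>) * \<eta>"
  have c0: "c \<ge> 0" using \<theta> \<eta> by (simp add: c_def)
  have pw0: "path_weight \<theta> \<eta> i i' \<ge> 0" for i i'
    using \<eta> by (simp add: path_weight_def)
  have [measurable]: "\<kappa> k \<in> measurable M (count_space UNIV)" for k
    unfolding \<kappa>_def round_def by measurable
  have [measurable]: "(\<lambda>x. H (\<kappa> a x) (\<kappa> b x)) \<in> borel_measurable M" for a b
    by (rule measurable_compose_countable[where f = "\<lambda>u x. H u (\<kappa> b x)" and g = "\<kappa> a"]) auto
  have round_err: "\<bar>u - round u\<bar> \<le> 1 / 2" for u :: real
    using of_int_round_abs_le[of u] by (simp add: abs_minus_commute)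
  have step: "g (\<theta> ^ k * X x) * g (\<theta> ^ Suc k * X x) \<le> path_weight \<theta> \<eta> (\<kappa> k x) (\<kappa> (Suc k) x)" for k x
  proof (cases "\<bar>\<kappa> (Suc k) x - \<theta> * \<kappa> k x\<bar> < 1 / 2")
    case True
    then show ?thesis
      using g01 by (auto simp: path_weight_def intro: mult_le_one)
  next
    case False
    define u where "u = \<theta> ^ k * X x"
    have \<theta>u: "\<theta> ^ Suc k * X x = \<theta> * u" by (simp add: u_def)
    have far: "1 / 2 \<le> \<bar>\<theta> * u - round (\<theta> * u)\<bar> + \<theta> * \<bar>u - round u\<bar>"
      using False round_expanding_step[OF \<theta>, of u] by (simp add: \<kappa>_def u_def mult.assoc)
    have "\<delta> \<le> \<bar>\<theta> * u - round (\<theta> * u)\<bar> \<or> \<delta> \<le> \<bar>u - round u\<bar>"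
    proof (rule ccontr)
      assume "\<not> ?thesis"
      then have "\<theta> * \<bar>u - round u\<bar> \<le> \<theta> * \<delta>" "\<bar>\<theta> * u - round (\<theta> * u)\<bar> < \<delta>"
        using \<theta> by (auto intro: mult_left_mono)
      then show False
        using far \<delta> by (simp add: distrib_left mult.commute)
    qed
    then have "g u * g (\<theta> * u) \<le> \<eta>"
    proof
      assume "\<delta> \<le> \<bar>\<theta> * u - round (\<theta> * u)\<bar>"
      then show ?thesis
        using g_far[of "\<theta> * u"] g01(1)[of "\<theta> * u"] mult_left_le_one_le[of "g (\<theta> * u)" "g u"] g01
        by force
    next
      assume "\<delta> \<le> \<bar>u - round u\<bar>"
      then show ?thesis
        using g_far[of u] g01(1)[of u] mult_right_le_one_le[of "g u" "g (\<theta> * u)"] g01 by force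
    qed
    with False show ?thesis
      by (simp only: path_weight_def \<theta>u u_def[symmetric] if_False)
  qed
  have prod_le: "(\<Prod>k\<le>l. (g (\<theta> ^ k * X x))\<^sup>2) \<le> (\<Prod>k<l. path_weight \<theta> \<eta> (\<kappa> k x) (\<kappa> (Suc k) x))" for x
  proof -
    let ?g = "\<lambda>k. g (\<theta> ^ k * X x)"
    have "(\<Prod>k\<le>l. (?g k)\<^sup>2) = (\<Prod>k\<le>l. ?g k) * (\<Prod>k\<le>l. ?g k)"
      by (simp add: power2_eq_square prod.distrib)
    also have "\<dots> \<le> (\<Prod>k<l. ?g k) * (\<Prod>k<l. ?g (Suc k))"
    proof (rule mult_mono)
      show "(\<Prod>k\<le>l. ?g k) \<le> (\<Prod>k<l. ?g k)"
        using g01 by (simp add: lessThan_Suc_atMost[symmetric] mult_left_le prod_nonneg)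
      show "(\<Prod>k\<le>l. ?g k) \<le> (\<Prod>k<l. ?g (Suc k))"
        unfolding lessThan_Suc_atMost[symmetric] prod.lessThan_Suc_shift
        using g01 by (intro mult_left_le_one_le prod_nonneg) auto
    qed (use g01 in \<open>auto intro: prod_nonneg\<close>)
    also have "\<dots> = (\<Prod>k<l. ?g k * ?g (Suc k))"
      by (simp add: prod.distrib)
    also have "\<dots> \<le> (\<Prod>k<l. path_weight \<theta> \<eta> (\<kappa> k x) (\<kappa> (Suc k) x))"
      using step g01 by (intro prod_mono) auto
    finally show ?thesis .
  qed
  define I where "I = {i::int. \<bar>i - 0\<bar> \<le> r + 1 / 2}"
  have I: "finite I" "real (card I) \<le> 2 * r + 2"
    using card_int_ball_le[of "r + 1 / 2" 0] r by (auto simp: I_def)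
  have branch: "(\<integral>\<^sup>+x. indicator {x \<in> space M. \<kappa> 0 x = i} x *
      (\<Prod>k<l. H (\<kappa> (0 + k) x) (\<kappa> (0 + Suc k) x)) \<partial>M) \<le> ennreal c ^ l * ennreal B" for i
  proof (rule nn_integral_path_weights_le)
    show "finite (N i)" for i
      unfolding N_def using card_int_ball_le(1)[of "(1 + \<theta>) / 2" "\<theta> * i"] \<theta> by simp
    show "\<kappa> (Suc k) x \<in> N (\<kappa> k x)" for k x
    proof -
      let ?u = "\<theta> ^ k * X x"
      have "\<theta> * \<bar>?u - round ?u\<bar> \<le> \<theta> * (1 / 2)"
        using \<theta> round_err[of ?u] by (intro mult_left_mono) auto
      then show ?thesis
        using round_expanding_step[OF \<theta>, of ?u] round_err[of "\<theta> * ?u"]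
        by (simp add: N_def \<kappa>_def mult.assoc)
    qed
    show "(\<Sum>i'\<in>N i. H i i') \<le> ennreal c" for i
    proof -
      have "(\<Sum>i'\<in>N i. H i i') = ennreal (\<Sum>i'\<in>N i. path_weight \<theta> \<eta> i i')"
        unfolding H_def using pw0 by (subst sum_ennreal) auto
      also have "\<dots> \<le> ennreal c"
        unfolding N_def c_def using sum_path_weight_le[OF \<theta> \<eta>, of i] by (rule ennreal_leI)
      finally show ?thesis .
    qed
    show "emeasure M {x \<in> space M. \<kappa> (0 + l) x = i} \<le> ennreal B" for i
      using B by (simp add: \<kappa>_def)
  qed simp
  have "(\<integral>\<^sup>+x. ennreal (\<Prod>k\<le>l. (g (\<theta> ^ k * X x))\<^sup>2) \<partial>M)
      \<le> (\<integral>\<^sup>+x. (\<Sum>i\<in>I. indicator {x \<in> space M. \<kappa> 0 x = i} x * (\<Prod>k<l. H (\<kappa> (0 + k) x) (\<kappa> (0 + Suc k) x))) \<partial>M)"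
  proof (rule nn_integral_mono_AE)
    show "AE x in M. ennreal (\<Prod>k\<le>l. (g (\<theta> ^ k * X x))\<^sup>2)
      \<le> (\<Sum>i\<in>I. indicator {x \<in> space M. \<kappa> 0 x = i} x * (\<Prod>k<l. H (\<kappa> (0 + k) x) (\<kappa> (0 + Suc k) x)))"
      using X AE_space
    proof eventually_elim
      case (elim x)
      have "\<bar>real_of_int (round (X x))\<bar> \<le> r + 1 / 2"
        using round_err[of "X x"] elim(1) by linarith
      then have "\<kappa> 0 x \<in> I"
        by (simp add: \<kappa>_def I_def)
      have "ennreal (\<Prod>k\<le>l. (g (\<theta> ^ k * X x))\<^sup>2)
          \<le> ennreal (\<Prod>k<l. path_weight \<theta> \<eta> (\<kappa> k x) (\<kappa> (Suc k) x))"
        by (rule ennreal_leI[OF prod_le])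
      also have "\<dots> = indicator {y \<in> space M. \<kappa> 0 y = \<kappa> 0 x} x * (\<Prod>k<l. H (\<kappa> (0 + k) x) (\<kappa> (0 + Suc k) x))"
        using elim pw0 by (simp add: H_def prod_ennreal)
      also have "\<dots> \<le> (\<Sum>i\<in>I. indicator {x \<in> space M. \<kappa> 0 x = i} x * (\<Prod>k<l. H (\<kappa> (0 + k) x) (\<kappa> (0 + Suc k) x)))"
        using \<open>\<kappa> 0 x \<in> I\<close> I by (intro member_le_sum) auto
      finally show ?case .
    qed
  qed
  also have "\<dots> = (\<Sum>i\<in>I. \<integral>\<^sup>+x. indicator {x \<in> space M. \<kappa> 0 x = i} x * (\<Prod>k<l. H (\<kappa> (0 + k) x) (\<kappa> (0 + Suc k) x)) \<partial>M)"
    by (subst nn_integral_sum) auto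
  also have "\<dots> \<le> (\<Sum>i\<in>I. ennreal c ^ l * ennreal B)"
    by (intro sum_mono branch)
  also have "\<dots> = ennreal (card I * (c ^ l * B))"
    using c0 B0 by (simp add: ennreal_mult ennreal_power ennreal_of_nat_eq_real_of_nat)
  also have "\<dots> \<le> ennreal ((2 * r + 2) * (c ^ l * B))"
    using I c0 B0 by (intro ennreal_leI mult_right_mono) auto
  finally show ?thesis by (simp add: c_def mult.assoc)
qed

section \<open>Self-similar measures with separated pieces\<close>

locale separated_self_similar_measure =
  fixes m :: nat and \<rho> :: real and a p :: "nat \<Rightarrow> real" and K :: "real set" and \<mu> :: "real measure"
  assumes m: "m \<ge> 2" and \<rho>: "0 < \<rho>" "\<rho> < 1"
    and attractor: "is_attractor m (homogeneous_ifs \<rho> a) K"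
    and separation: "strong_separation m (homogeneous_ifs \<rho> a) K"
    and weights: "positive_probability_vector m p"
    and self_similar: "self_similar_measure m (homogeneous_ifs \<rho> a) p K \<mu>"
begin

lemma p_pos: "j \<in> {1..m} \<Longrightarrow> p j > 0" and sum_p: "(\<Sum>j=1..m. p j) = 1"
  using weights by (auto simp: positive_probability_vector_def)

lemma K: "K \<noteq> {}" "compact K"
  using attractor unfolding is_attractor_def by blast+

lemma K_maps: "x \<in> K \<Longrightarrow> j \<in> {1..m} \<Longrightarrow> \<rho> * x + a j \<in> K"
  using attractor unfolding is_attractor_def homogeneous_ifs_def by blast

sublocale real_distribution \<mu>
  using self_similar
  by (auto simp: self_similar_measure_def real_distribution_def real_distribution_axioms_def
      intro: sets_eq_imp_space_eq[of _ borel, simplified])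

lemma prob_UNIV: "measure \<mu> UNIV = 1"
  using prob_space by simp

lemma AE_K: "AE x in \<mu>. x \<in> K"
proof (rule AE_I')
  show "- K \<in> null_sets \<mu>"
    using self_similar K by (auto simp: self_similar_measure_def compact_imp_closed borel_closed)
qed auto

lemma measure_self_similar:
  assumes [measurable]: "A \<in> sets borel"
  shows "measure \<mu> A = (\<Sum>j=1..m. p j * measure \<mu> {x. \<rho> * x + a j \<in> A})"
proof -
  have "measure (distr \<mu> borel (homogeneous_ifs \<rho> a j)) A = measure \<mu> {x. \<rho> * x + a j \<in> A}" for j
    unfolding homogeneous_ifs_def by (subst measure_distr) (auto simp: vimage_def)
  then show ?thesis
    using self_similar assms by (simp add: self_similar_measure_def)
qed

text \<open>
  Self-similarity is given for measures of sets; monotone class induction carries it to integrals.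
\<close>

lemma nn_integral_self_similar:
  fixes g :: "real \<Rightarrow> ennreal"
  assumes "g \<in> borel_measurable borel"
  shows "(\<integral>\<^sup>+x. g x \<partial>\<mu>) = (\<Sum>j=1..m. ennreal (p j) * (\<integral>\<^sup>+x. g (\<rho> * x + a j) \<partial>\<mu>))"
  using assms
proof (induction rule: borel_measurable_induct)
  case (cong f g)
  then show ?case by (simp cong: nn_integral_cong)
next
  case (set A)
  have [measurable]: "{x. \<rho> * x + a j \<in> A} \<in> sets borel" for j
    using set by measurable
  have ind: "indicator A (\<rho> * x + a j) = (indicator {x. \<rho> * x + a j \<in> A} x :: ennreal)" for j x
    by (simp add: indicator_def)
  have "(\<integral>\<^sup>+x. indicator A (\<rho> * x + a j) \<partial>\<mu>) = emeasure \<mu> {x. \<rho> * x + a j \<in> A}" for j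
    unfolding ind by (rule nn_integral_indicator) simp
  moreover have "ennreal (p j * measure \<mu> {x. \<rho> * x + a j \<in> A})
      = ennreal (p j) * emeasure \<mu> {x. \<rho> * x + a j \<in> A}" if "j \<in> {1..m}" for j
    using p_pos[OF that] by (simp add: emeasure_eq_measure ennreal_mult less_imp_le)
  moreover have "emeasure \<mu> A = (\<Sum>j=1..m. ennreal (p j * measure \<mu> {x. \<rho> * x + a j \<in> A}))"
    using set p_pos
    by (subst sum_ennreal) (auto simp: emeasure_eq_measure measure_self_similar[of A] less_imp_le)
  ultimately show ?case
    using set by simp
next
  case (mult u c)
  then show ?case
    by (simp add: nn_integral_cmult sum_distrib_left mult_ac)
next
  case (add u v)
  then show ?case
    by (simp add: nn_integral_add sum.distrib distrib_left)
next
  case (seq U)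
  have [measurable]: "U i \<in> borel_measurable borel" for i by fact
  have inc: "incseq (\<lambda>i x. U i (\<rho> * x + a j))" for j
    using seq by (auto simp: incseq_def le_fun_def)
  have SUP_U: "(SUP i. U i) = (\<lambda>x. SUP i. U i x)"
    by (simp add: fun_eq_iff image_image)
  have "(\<integral>\<^sup>+x. (SUP i. U i x) \<partial>\<mu>) = (SUP i. \<integral>\<^sup>+x. U i x \<partial>\<mu>)"
    using seq by (intro nn_integral_monotone_convergence_SUP) auto
  also have "\<dots> = (SUP i. \<Sum>j=1..m. ennreal (p j) * (\<integral>\<^sup>+x. U i (\<rho> * x + a j) \<partial>\<mu>))"
    using seq by simp
  also have "\<dots> = (\<Sum>j=1..m. SUP i. ennreal (p j) * (\<integral>\<^sup>+x. U i (\<rho> * x + a j) \<partial>\<mu>))"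
    using inc by (intro ennreal_SUP_sum)
      (auto simp: incseq_def le_fun_def intro!: mult_left_mono nn_integral_mono)
  also have "\<dots> = (\<Sum>j=1..m. ennreal (p j) * (\<integral>\<^sup>+x. (SUP i. U i (\<rho> * x + a j)) \<partial>\<mu>))"
    using inc by (intro sum.cong refl)
      (subst nn_integral_monotone_convergence_SUP, auto simp: SUP_mult_left_ennreal)
  finally show ?case by (simp add: SUP_U)
qed

lemma integral_self_similar_real:
  fixes g :: "real \<Rightarrow> real"
  assumes [measurable]: "g \<in> borel_measurable borel" and B: "\<And>x. \<bar>g x\<bar> \<le> B"
  shows "(\<integral>x. g x \<partial>\<mu>) = (\<Sum>j=1..m. p j * (\<integral>x. g (\<rho> * x + a j) \<partial>\<mu>))"
proof -
  have int: "integrable \<mu> g" "integrable \<mu> (\<lambda>x. g (\<rho> * x + a j))" for j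
    using B by (auto intro!: integrable_const_bound[where B = B])
  have nonneg: "g x + B \<ge> 0" for x
    using B[of x] by linarith
  define E where "E j = (\<integral>x. g (\<rho> * x + a j) + B \<partial>\<mu>)" for j
  have E_nonneg: "E j \<ge> 0" for j
    unfolding E_def using nonneg by (intro Bochner_Integration.integral_nonneg)
  have E_eq: "ennreal (E j) = (\<integral>\<^sup>+x. ennreal (g (\<rho> * x + a j) + B) \<partial>\<mu>)" for j
    unfolding E_def using int nonneg by (intro nn_integral_eq_integral[symmetric]) auto
  have pE: "p j * E j \<ge> 0" "ennreal (p j * E j) = ennreal (p j) * ennreal (E j)" if "j \<in> {1..m}" for j
    using p_pos[OF that] E_nonneg[of j] by (auto intro!: ennreal_mult)
  have "ennreal (\<integral>x. g x + B \<partial>\<mu>) = (\<integral>\<^sup>+x. ennreal (g x + B) \<partial>\<mu>)"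
    using int nonneg by (intro nn_integral_eq_integral[symmetric]) auto
  also have "\<dots> = (\<Sum>j=1..m. ennreal (p j) * ennreal (E j))"
    unfolding E_eq by (rule nn_integral_self_similar) measurable
  also have "\<dots> = (\<Sum>j=1..m. ennreal (p j * E j))"
    using pE(2) by (intro sum.cong) auto
  also have "\<dots> = ennreal (\<Sum>j=1..m. p j * E j)"
    using pE(1) by (rule sum_ennreal)
  finally have "(\<integral>x. g x + B \<partial>\<mu>) = (\<Sum>j=1..m. p j * E j)"
    using pE(1) Bochner_Integration.integral_nonneg[of \<mu> "\<lambda>x. g x + B"] nonneg
    by (subst (asm) ennreal_inj) (auto intro!: sum_nonneg simp del: Bochner_Integration.integral_add)
  also have "\<dots> = (\<Sum>j=1..m. p j * (\<integral>x. g (\<rho> * x + a j) \<partial>\<mu>)) + (\<Sum>j=1..m. p j) * B"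
    using int by (simp add: E_def prob_UNIV distrib_left sum.distrib sum_distrib_right)
  finally show ?thesis
    using int sum_p by (simp add: prob_UNIV)
qed

lemma integral_self_similar:
  fixes g :: "real \<Rightarrow> complex"
  assumes [measurable]: "g \<in> borel_measurable borel" and B: "\<And>x. norm (g x) \<le> B"
  shows "(\<integral>x. g x \<partial>\<mu>) = (\<Sum>j=1..m. p j * (\<integral>x. g (\<rho> * x + a j) \<partial>\<mu>))"
proof (rule complex_eqI)
  have int: "integrable \<mu> g" "integrable \<mu> (\<lambda>x. g (\<rho> * x + a j))" for j
    using B by (auto intro!: integrable_const_bound[where B = B])
  have "(\<integral>x. Re (g x) \<partial>\<mu>) = (\<Sum>j=1..m. p j * (\<integral>x. Re (g (\<rho> * x + a j)) \<partial>\<mu>))"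
    using B by (intro integral_self_similar_real[where B = B]) (auto intro: order_trans[OF abs_Re_le_cmod])
  then show "Re (\<integral>x. g x \<partial>\<mu>) = Re (\<Sum>j=1..m. p j * (\<integral>x. g (\<rho> * x + a j) \<partial>\<mu>))"
    using int by simp
  have "(\<integral>x. Im (g x) \<partial>\<mu>) = (\<Sum>j=1..m. p j * (\<integral>x. Im (g (\<rho> * x + a j)) \<partial>\<mu>))"
    using B by (intro integral_self_similar_real[where B = B]) (auto intro: order_trans[OF abs_Im_le_cmod])
  then show "Im (\<integral>x. g x \<partial>\<mu>) = Im (\<Sum>j=1..m. p j * (\<integral>x. g (\<rho> * x + a j) \<partial>\<mu>))"
    using int by simp
qed

text \<open>
  Iterating self-similarity \<open>n\<close> times writes \<open>\<mu>\<close> as a convex combination of its images under the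
  maps \<open>x \<mapsto> y + \<rho>\<^sup>n x\<close> of cylinders into \<open>K\<close>; a comparison that holds on each of them therefore holds
  for \<open>\<mu>\<close>. The induction on \<open>n\<close> refines one cylinder at a time, which avoids naming the words of
  length \<open>n\<close>.
\<close>

lemma norm_integral_le_by_cylinders:
  fixes G :: "real \<Rightarrow> complex" and F :: "real \<Rightarrow> real"
  assumes [measurable]: "G \<in> borel_measurable borel" "F \<in> borel_measurable borel"
    and G: "\<And>x. norm (G x) \<le> B" and F: "\<And>x. \<bar>F x\<bar> \<le> B"
    and cyl: "\<And>y. (\<And>x. x \<in> K \<Longrightarrow> y + \<rho> ^ n * x \<in> K) \<Longrightarrow>
      norm (\<integral>x. G (y + \<rho> ^ n * x) \<partial>\<mu>) \<le> (\<integral>x. F (y + \<rho> ^ n * x) \<partial>\<mu>)"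
  shows "norm (\<integral>x. G x \<partial>\<mu>) \<le> (\<integral>x. F x \<partial>\<mu>)"
  using cyl
proof (induction n)
  case 0
  from 0[of 0] show ?case by simp
next
  case (Suc n)
  show ?case
  proof (rule Suc.IH)
    fix y assume y: "\<And>x. x \<in> K \<Longrightarrow> y + \<rho> ^ n * x \<in> K"
    have eq: "y + \<rho> ^ n * (\<rho> * x + a j) = (y + \<rho> ^ n * a j) + \<rho> ^ Suc n * x" for x j
      by (simp add: algebra_simps)
    have "(\<integral>x. G (y + \<rho> ^ n * x) \<partial>\<mu>) = (\<Sum>j=1..m. p j * (\<integral>x. G (y + \<rho> ^ n * (\<rho> * x + a j)) \<partial>\<mu>))"
      using G by (intro integral_self_similar[where B = B]) auto
    also have "norm \<dots> \<le> (\<Sum>j=1..m. p j * (\<integral>x. F (y + \<rho> ^ n * (\<rho> * x + a j)) \<partial>\<mu>))"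
    proof (rule sum_norm_le)
      fix j assume j: "j \<in> {1..m}"
      have "norm (\<integral>x. G (y + \<rho> ^ n * (\<rho> * x + a j)) \<partial>\<mu>) \<le> (\<integral>x. F (y + \<rho> ^ n * (\<rho> * x + a j)) \<partial>\<mu>)"
        unfolding eq
      proof (rule Suc.prems)
        show "(y + \<rho> ^ n * a j) + \<rho> ^ Suc n * x \<in> K" if "x \<in> K" for x
          unfolding eq[symmetric] using that j by (intro y K_maps)
      qed
      then show "norm (p j * (\<integral>x. G (y + \<rho> ^ n * (\<rho> * x + a j)) \<partial>\<mu>))
          \<le> p j * (\<integral>x. F (y + \<rho> ^ n * (\<rho> * x + a j)) \<partial>\<mu>)"
        using p_pos[OF j] by (simp add: norm_mult)
    qed
    also have "\<dots> = (\<integral>x. F (y + \<rho> ^ n * x) \<partial>\<mu>)"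
      using F by (intro integral_self_similar_real[where B = B, symmetric]) auto
    finally show "norm (\<integral>x. G (y + \<rho> ^ n * x) \<partial>\<mu>) \<le> (\<integral>x. F (y + \<rho> ^ n * x) \<partial>\<mu>)" .
  qed
qed

lemma separation_gap:
  obtains c where "c > 0"
    "\<And>i j x y. i \<in> {1..m} \<Longrightarrow> j \<in> {1..m} \<Longrightarrow> i \<noteq> j \<Longrightarrow> x \<in> K \<Longrightarrow> y \<in> K \<Longrightarrow>
      c \<le> \<bar>(\<rho> * x + a i) - (\<rho> * y + a j)\<bar>"
proof -
  let ?f = "\<lambda>j x. \<rho> * x + a j"
  define c where "c i j = setdist (?f i ` K) (?f j ` K)" for i j
  have c_pos: "c i j > 0" if "i \<in> {1..m}" "j \<in> {1..m}" "i \<noteq> j" for i j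
  proof -
    have "compact (?f i ` K)" "compact (?f j ` K)"
      using K by (auto intro!: compact_continuous_image continuous_intros)
    moreover have "?f i ` K \<inter> ?f j ` K = {}"
      using disjoint_family_onD[OF separation[unfolded strong_separation_def], of i j] that
      by (simp add: homogeneous_ifs_def)
    ultimately show ?thesis
      using K unfolding c_def by (simp add: setdist_gt_0_compact_closed compact_imp_closed)
  qed
  have c_le: "c i j \<le> \<bar>?f i x - ?f j y\<bar>" if "x \<in> K" "y \<in> K" for i j x y
    using that unfolding c_def dist_real_def[symmetric] by (intro setdist_le_dist) auto
  define P where "P = {(i, j) \<in> {1..m} \<times> {1..m}. i \<noteq> j}"
  have fin: "finite P" unfolding P_def by (rule finite_subset[of _ "{1..m} \<times> {1..m}"]) auto
  have "(1, 2) \<in> P" using m by (auto simp: P_def)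
  then have ne: "P \<noteq> {}" by auto
  show thesis
  proof (rule that[of "Min ((\<lambda>(i, j). c i j) ` P)"])
    show "Min ((\<lambda>(i, j). c i j) ` P) > 0"
      using fin ne c_pos by (subst Min_gr_iff) (auto simp: P_def)
    fix i j x y assume *: "i \<in> {1..m}" "j \<in> {1..m}" "i \<noteq> j" "x \<in> K" "y \<in> K"
    then have "Min ((\<lambda>(i, j). c i j) ` P) \<le> c i j"
      using fin by (intro Min_le) (auto simp: P_def image_iff)
    also have "\<dots> \<le> \<bar>?f i x - ?f j y\<bar>"
      using * by (intro c_le)
    finally show "Min ((\<lambda>(i, j). c i j) ` P) \<le> \<bar>?f i x - ?f j y\<bar>" .
  qed
qed

lemma max_weight:
  obtains q where "0 < q" "q < 1" "\<And>j. j \<in> {1..m} \<Longrightarrow> p j \<le> q"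
proof
  have ne: "p ` {1..m} \<noteq> {}" using m by auto
  show "p j \<le> Max (p ` {1..m})" if "j \<in> {1..m}" for j
    using that by auto
  show "0 < Max (p ` {1..m})"
    using ne p_pos by (subst Max_gr_iff) (use m in \<open>auto intro!: bexI[of _ 1]\<close>)
  have "p j < 1" if j: "j \<in> {1..m}" for j
  proof -
    define i where "i = (if j = 1 then 2 else 1 :: nat)"
    have i: "i \<in> {1..m}" "i \<noteq> j"
      using m by (auto simp: i_def)
    have "p j + p i = sum p {i, j}" using i by simp
    also have "\<dots> \<le> (\<Sum>j=1..m. p j)"
      using i j p_pos by (intro sum_mono2) (auto simp: less_imp_le)
    finally show ?thesis using p_pos[OF i(1)] sum_p by linarith
  qed
  then show "Max (p ` {1..m}) < 1"
    using ne by (subst Max_less_iff) auto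
qed

text \<open>
  An interval shorter than the gap between the pieces of \<open>K\<close> meets at most one piece. Its mass is
  then at most \<open>q\<close> times the mass of an interval that is longer by the factor \<open>1 / \<rho>\<close>, where \<open>q < 1\<close>
  bounds the weights. Iterating gives decay \<open>q\<^sup>l\<close> for lengths comparable to \<open>\<rho>\<^sup>l\<close>, that is, positive
  dimension.
\<close>

lemma frostman:
  obtains q where "0 < q" "q < 1"
    "\<And>W. W > 0 \<Longrightarrow> \<exists>C>0. \<forall>l u v. v - u \<le> W * \<rho> ^ l \<longrightarrow> measure \<mu> {u..v} \<le> C * q ^ l"
proof -
  obtain q where q: "0 < q" "q < 1" "\<And>j. j \<in> {1..m} \<Longrightarrow> p j \<le> q" by (rule max_weight) blast
  obtain c where c: "c > 0" "\<And>i j x y. i \<in> {1..m} \<Longrightarrow> j \<in> {1..m} \<Longrightarrow> i \<noteq> j \<Longrightarrow> x \<in> K \<Longrightarrow> y \<in> K \<Longrightarrow>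
      c \<le> \<bar>(\<rho> * x + a i) - (\<rho> * y + a j)\<bar>" by (rule separation_gap) blast
  have basic: "measure \<mu> {u..v} \<le> q ^ n" if "v - u < c * \<rho> ^ n" for n u v
    using that
  proof (induction n arbitrary: u v)
    case 0
    then show ?case by simp
  next
    case (Suc n)
    let ?I = "\<lambda>j. {x. \<rho> * x + a j \<in> {u..v}}"
    have I_eq: "?I j = {(u - a j) / \<rho>..(v - a j) / \<rho>}" for j
      using \<rho> by (auto simp: field_simps)
    have small: "measure \<mu> (?I j) \<le> q ^ n" for j
      unfolding I_eq
    proof (rule Suc.IH)
      have "(v - a j) / \<rho> - (u - a j) / \<rho> = (v - u) / \<rho>"
        by (simp add: diff_divide_distrib)
      also have "\<dots> < c * \<rho> ^ n"
        using Suc.prems \<rho> by (simp add: field_simps)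
      finally show "(v - a j) / \<rho> - (u - a j) / \<rho> < c * \<rho> ^ n" .
    qed
    have null: "measure \<mu> (?I j) = 0" if "?I j \<inter> K = {}" for j
    proof -
      have "AE x in \<mu>. x \<notin> ?I j"
        using AE_K by eventually_elim (use that in auto)
      then show ?thesis
        by (subst measure_eq_AE[where B = "{}"]) (auto simp: I_eq)
    qed
    have gap: "i = j" if ij: "i \<in> {1..m}" "j \<in> {1..m}" and meet: "?I i \<inter> K \<noteq> {}" "?I j \<inter> K \<noteq> {}" for i j
    proof (rule ccontr)
      assume "i \<noteq> j"
      obtain x y where xy: "x \<in> K" "y \<in> K" "\<rho> * x + a i \<in> {u..v}" "\<rho> * y + a j \<in> {u..v}"
        using meet by auto
      have "\<rho> ^ Suc n \<le> 1" using \<rho> by (intro power_le_one) auto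
      then have "c * \<rho> ^ Suc n \<le> c * 1" using c(1) by (intro mult_left_mono) auto
      moreover have "\<bar>(\<rho> * x + a i) - (\<rho> * y + a j)\<bar> \<le> v - u"
        using xy by auto
      ultimately show False
        using c(2)[OF ij \<open>i \<noteq> j\<close> xy(1,2)] Suc.prems by linarith
    qed
    have "measure \<mu> {u..v} = (\<Sum>j=1..m. p j * measure \<mu> (?I j))"
      by (rule measure_self_similar) simp
    also have "\<dots> \<le> q ^ Suc n"
    proof (cases "\<exists>j\<in>{1..m}. ?I j \<inter> K \<noteq> {}")
      case True
      then obtain i where i: "i \<in> {1..m}" "?I i \<inter> K \<noteq> {}" by blast
      have "(\<Sum>j=1..m. p j * measure \<mu> (?I j)) = (\<Sum>j\<in>{i}. p j * measure \<mu> (?I j))"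
      proof (rule sum.mono_neutral_right)
        show "\<forall>j\<in>{1..m} - {i}. p j * measure \<mu> (?I j) = 0"
        proof
          fix j assume j: "j \<in> {1..m} - {i}"
          then have "?I j \<inter> K = {}"
            using gap[OF _ i(1) _ i(2), of j] by blast
          then have "measure \<mu> (?I j) = 0" by (rule null)
          then show "p j * measure \<mu> (?I j) = 0" by (simp only: mult_zero_right)
        qed
      qed (use i in auto)
      also have "\<dots> \<le> q * q ^ n"
        using q p_pos[OF i(1)] small[of i] i by (auto intro!: mult_mono)
      finally show ?thesis by simp
    next
      case False
      then show ?thesis using null q by simp
    qed
    finally show ?case .
  qed
  have "\<exists>C>0. \<forall>l u v. v - u \<le> W * \<rho> ^ l \<longrightarrow> measure \<mu> {u..v} \<le> C * q ^ l" if W: "W > 0" for W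
  proof -
    \<comment> \<open>A shift by \<open>d\<close> generations absorbs the constant \<open>W\<close>; it costs the factor \<open>1 / q ^ d\<close>.\<close>
    obtain d where d: "\<rho> ^ d < c / W"
      using real_arch_pow_inv[of "c / W" \<rho>] \<rho> c W by auto
    show ?thesis
    proof (intro exI[of _ "1 / q ^ d"] conjI allI impI)
      fix l u v assume uv: "v - u \<le> W * \<rho> ^ l"
      show "measure \<mu> {u..v} \<le> 1 / q ^ d * q ^ l"
      proof (cases "d \<le> l")
        case True
        have "W * \<rho> ^ l = (W * \<rho> ^ d) * \<rho> ^ (l - d)"
          using True by (simp flip: power_add)
        also have "\<dots> < c * \<rho> ^ (l - d)"
          using d W \<rho> by (intro mult_strict_right_mono) (auto simp: field_simps)
        finally have "measure \<mu> {u..v} \<le> q ^ (l - d)"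
          using uv by (intro basic) linarith
        then show ?thesis
          using True q by (simp add: power_diff)
      next
        case False
        then have "q ^ d \<le> q ^ l"
          using q by (intro power_decreasing) auto
        then have "1 \<le> 1 / q ^ d * q ^ l"
          using q by (simp add: field_simps)
        then show ?thesis
          using prob_le_1[of "{u..v}"] by linarith
      qed
    qed (use q in auto)
  qed
  with q show thesis by (intro that)
qed

end

section \<open>Average decay of the Fourier transform\<close>

text \<open>
  The triangle inequality for \<open>c + d e(u)\<close> is strict away from the integers, uniformly so at distance
  at least \<open>\<delta>\<close>.
\<close>

lemma norm_two_point_sum_le:
  fixes c d \<delta> :: real
  assumes c: "c > 0" and d: "d > 0" and \<delta>: "0 < \<delta>" "\<delta> \<le> 1 / 2"
  obtains r where "0 \<le> r" "r < c + d"
    "\<And>u::real. \<bar>u - round u\<bar> \<ge> \<delta> \<Longrightarrow> norm (of_real c + of_real d * cis (2 * pi * u)) \<le> r"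
proof
  define r where "r = sqrt ((c + d)\<^sup>2 - 2 * c * d * (1 - cos (2 * pi * \<delta>)))"
  have pos: "cos (2 * pi * \<delta>) < 1"
    using cos_monotone_0_pi[of 0 "2 * pi * \<delta>"] \<delta> by simp
  have "(c + d)\<^sup>2 - 2 * c * d * (1 - cos (2 * pi * \<delta>)) < (c + d)\<^sup>2"
    using c d pos by simp
  then have "r < sqrt ((c + d)\<^sup>2)"
    unfolding r_def by (rule real_sqrt_less_mono)
  with c d show "r < c + d" by simp
  have "2 * c * d * (1 - cos (2 * pi * \<delta>)) \<le> 2 * c * d * 2"
    using c d by (intro mult_left_mono) (auto simp: cos_ge_minus_one)
  also have "\<dots> \<le> (c + d)\<^sup>2"
    using sum_squares_ge_zero[of "c - d" 0] by (simp add: power2_eq_square algebra_simps)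
  finally show "0 \<le> r" unfolding r_def by simp
  fix u :: real assume far: "\<bar>u - round u\<bar> \<ge> \<delta>"
  define v where "v = \<bar>u - round u\<bar>"
  have v: "\<delta> \<le> v" "v \<le> 1 / 2"
    using far of_int_round_abs_le[of u] by (auto simp: v_def abs_minus_commute)
  have "cos (2 * pi * u) = cos (2 * pi * (u - round u))"
    by (simp add: right_diff_distrib cos_diff)
  also have "\<dots> = cos (2 * pi * v)"
    using cos_abs_real[of "2 * pi * (u - round u)"] by (simp add: v_def abs_mult)
  also have "\<dots> \<le> cos (2 * pi * \<delta>)"
    using v \<delta> by (intro cos_monotone_0_pi_le) auto
  finally have cos: "cos (2 * pi * u) \<le> cos (2 * pi * \<delta>)" .
  have "(norm (of_real c + of_real d * cis (2 * pi * u)))\<^sup>2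
      = (c + d * cos (2 * pi * u))\<^sup>2 + (d * sin (2 * pi * u))\<^sup>2"
    by (simp add: cmod_power2)
  also have "\<dots> = c\<^sup>2 + 2 * c * d * cos (2 * pi * u) + d\<^sup>2 * ((cos (2 * pi * u))\<^sup>2 + (sin (2 * pi * u))\<^sup>2)"
    by algebra
  also have "\<dots> = (c + d)\<^sup>2 - 2 * c * d * (1 - cos (2 * pi * u))"
    by (simp only: sin_cos_squared_add2) (simp add: power2_eq_square algebra_simps)
  also have "\<dots> \<le> (c + d)\<^sup>2 - 2 * c * d * (1 - cos (2 * pi * \<delta>))"
    using cos c d by (intro diff_left_mono mult_left_mono) auto
  finally show "norm (of_real c + of_real d * cis (2 * pi * u)) \<le> r"
    unfolding r_def by (rule real_le_rsqrt)
qed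

context separated_self_similar_measure begin

text \<open>
  The Fourier transform of the discrete measure with mass \<open>p j\<close> at \<open>a j\<close>; self-similarity says that
  \<open>\<mu>\<close> is its convolution with the copy of \<open>\<mu>\<close> scaled by \<open>\<rho>\<close>.
\<close>

definition mask :: "real \<Rightarrow> complex" where
  "mask t = (\<Sum>j=1..m. p j * iexp (t * a j))"

lemma norm_mask_le_1: "norm (mask t) \<le> 1"
proof -
  have "norm (mask t) \<le> (\<Sum>j=1..m. p j)"
    unfolding mask_def using p_pos by (intro sum_norm_le) (auto simp: norm_mult less_imp_le)
  then show ?thesis using sum_p by simp
qed

lemma char_self_similar: "char \<mu> t = mask t * char \<mu> (\<rho> * t)"
proof -
  have "char \<mu> t = (\<Sum>j=1..m. p j * (\<integral>x. iexp (t * (\<rho> * x + a j)) \<partial>\<mu>))"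
    unfolding char_def by (rule integral_self_similar[where B = 1]) auto
  also have "\<dots> = (\<Sum>j=1..m. p j * iexp (t * a j) * char \<mu> (\<rho> * t))"
  proof (rule sum.cong)
    fix j
    have "iexp (t * (\<rho> * x + a j)) = iexp (t * a j) * iexp ((\<rho> * t) * x)" for x
      by (simp add: algebra_simps flip: exp_add)
    then show "p j * (\<integral>x. iexp (t * (\<rho> * x + a j)) \<partial>\<mu>) = p j * iexp (t * a j) * char \<mu> (\<rho> * t)"
      by (simp add: char_def)
  qed simp
  also have "\<dots> = mask t * char \<mu> (\<rho> * t)"
    by (simp add: mask_def sum_distrib_right)
  finally show ?thesis .
qed

lemma norm_char_le_prod: "norm (char \<mu> t) \<le> (\<Prod>k<n. norm (mask (\<rho> ^ k * t)))"
proof -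
  have "norm (char \<mu> t) = (\<Prod>k<n. norm (mask (\<rho> ^ k * t))) * norm (char \<mu> (\<rho> ^ n * t))"
  proof (induction n)
    case (Suc n)
    then show ?case
      using char_self_similar[of "\<rho> ^ n * t"] by (simp add: norm_mult mult.assoc)
  qed simp
  also have "\<dots> \<le> (\<Prod>k<n. norm (mask (\<rho> ^ k * t))) * 1"
    by (intro mult_left_mono cmod_char_le_1 prod_nonneg) auto
  finally show ?thesis by simp
qed

text \<open>
  The first two terms of \<open>mask t\<close> are in phase exactly when \<open>digit_ratio * t\<close> is an integer.
\<close>

definition digit_ratio :: real where
  "digit_ratio = (a 2 - a 1) / (2 * pi)"

text \<open>
  If \<open>a 1 = a 2\<close>, the first two pieces of \<open>K\<close> would coincide.
\<close>

lemma digit_ratio_nonzero: "digit_ratio \<noteq> 0"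
proof
  assume "digit_ratio = 0"
  then have eq: "a 1 = a 2" by (simp add: digit_ratio_def)
  obtain c where c: "c > 0" "\<And>i j x y. i \<in> {1..m} \<Longrightarrow> j \<in> {1..m} \<Longrightarrow> i \<noteq> j \<Longrightarrow> x \<in> K \<Longrightarrow> y \<in> K \<Longrightarrow>
      c \<le> \<bar>(\<rho> * x + a i) - (\<rho> * y + a j)\<bar>" by (rule separation_gap) blast
  obtain x where "x \<in> K" using K by auto
  with c(2)[of 1 2 x x] c(1) eq m show False by simp
qed

lemma mask_bound_off_lattice:
  assumes "0 < \<delta>" "\<delta> \<le> 1 / 2"
  obtains r where "0 \<le> r" "r < 1"
    "\<And>t. \<bar>digit_ratio * t - round (digit_ratio * t)\<bar> \<ge> \<delta> \<Longrightarrow> norm (mask t) \<le> r"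
proof -
  have p12: "p 1 > 0" "p 2 > 0" using p_pos m by auto
  obtain s where s: "0 \<le> s" "s < p 1 + p 2"
    "\<And>u::real. \<bar>u - round u\<bar> \<ge> \<delta> \<Longrightarrow> norm (of_real (p 1) + of_real (p 2) * cis (2 * pi * u)) \<le> s"
    using norm_two_point_sum_le[OF p12 assms] by blast
  have split: "(\<Sum>j=1..m. f j) = f 1 + f 2 + (\<Sum>j=3..m. f j)" for f :: "nat \<Rightarrow> 'b::comm_monoid_add"
  proof -
    have "{1..m} = insert 1 (insert 2 {3..m})" using m by auto
    then show ?thesis by (simp add: add.assoc)
  qed
  have rest: "(\<Sum>j=3..m. p j) = 1 - (p 1 + p 2)"
    using split[of p] sum_p by linarith
  show thesis
  proof (rule that[of "s + (1 - (p 1 + p 2))"])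
    have "(\<Sum>j=3..m. p j) \<ge> 0" using p_pos by (intro sum_nonneg) (auto simp: less_imp_le)
    then show "0 \<le> s + (1 - (p 1 + p 2))" using s rest by linarith
    show "s + (1 - (p 1 + p 2)) < 1" using s by linarith
    fix t assume far: "\<bar>digit_ratio * t - round (digit_ratio * t)\<bar> \<ge> \<delta>"
    have arg: "2 * pi * (digit_ratio * t) = t * a 2 - t * a 1"
      by (simp add: digit_ratio_def field_simps)
    have "p 1 * iexp (t * a 1) + p 2 * iexp (t * a 2)
        = iexp (t * a 1) * (of_real (p 1) + of_real (p 2) * cis (2 * pi * (digit_ratio * t)))"
      unfolding arg by (simp add: cis_conv_exp algebra_simps flip: exp_add)
    then have "norm (p 1 * iexp (t * a 1) + p 2 * iexp (t * a 2))
        = norm (of_real (p 1) + of_real (p 2) * cis (2 * pi * (digit_ratio * t)))"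
      by (simp add: norm_mult)
    also have "\<dots> \<le> s" by (rule s(3)[OF far])
    finally have "norm (p 1 * iexp (t * a 1) + p 2 * iexp (t * a 2)) \<le> s" .
    moreover have "norm (\<Sum>j=3..m. p j * iexp (t * a j)) \<le> (\<Sum>j=3..m. p j)"
      using p_pos by (intro sum_norm_le) (auto simp: norm_mult less_imp_le)
    ultimately show "norm (mask t) \<le> s + (1 - (p 1 + p 2))"
      unfolding mask_def split rest[symmetric] by (intro norm_triangle_mono)
  qed
qed

text \<open>
  The Fourier transform of \<open>\<mu>\<close> at \<open>T \<psi>(x)\<close>, with \<open>\<bar>T\<bar>\<close> comparable to \<open>\<rho>\<^sup>-\<^sup>l\<close>, is at most the product
  \<open>F x\<close> of \<open>l + 1\<close> values of the mask. A point \<open>x\<close> with prescribed nearest integer at the last level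
  lies in an interval of length about \<open>\<rho>\<^sup>l\<close>, as \<open>\<psi>\<close> expands distances by at least \<open>b\<close>; hence it has
  mass at most a constant times \<open>q\<^sup>l\<close>. The tree contributes \<open>(1 + (2 + \<theta>) \<eta>)\<^sup>l\<close>, and \<open>\<eta>\<close> is
  chosen so small that the product of the two still decays. A large power \<open>2 Q\<close> of \<open>F\<close> achieves this
  \<open>\<eta>\<close>, and Markov's inequality returns from the power to \<open>F\<close> itself.
\<close>

lemma char_average_decay:
  fixes \<psi> :: "real \<Rightarrow> real" and b B \<Lambda> :: real
  assumes [measurable]: "\<psi> \<in> borel_measurable borel"
    and b: "b > 0" and expand: "\<And>x y. x \<in> K \<Longrightarrow> y \<in> K \<Longrightarrow> b * \<bar>x - y\<bar> \<le> \<bar>\<psi> x - \<psi> y\<bar>"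
    and B: "B \<ge> 0" "\<And>x. x \<in> K \<Longrightarrow> \<bar>\<psi> x\<bar> \<le> B" and \<Lambda>: "\<Lambda> \<ge> 0"
  obtains C \<sigma> where "C \<ge> 0" "0 < \<sigma>" "\<sigma> < 1"
    "\<And>l T. 1 \<le> \<bar>T\<bar> * \<rho> ^ l \<Longrightarrow> \<bar>T\<bar> * \<rho> ^ l \<le> \<Lambda> \<Longrightarrow> (\<integral>x. norm (char \<mu> (T * \<psi> x)) \<partial>\<mu>) \<le> C * \<sigma> ^ l"
proof -
  define \<theta> where "\<theta> = 1 / \<rho>"
  have \<theta>: "\<theta> > 1" using \<rho> by (simp add: \<theta>_def)
  obtain q where q: "0 < q" "q < 1"
    "\<And>W. W > 0 \<Longrightarrow> \<exists>C>0. \<forall>l u v. v - u \<le> W * \<rho> ^ l \<longrightarrow> measure \<mu> {u..v} \<le> C * q ^ l"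
    using frostman by blast
  define \<alpha> where "\<alpha> = digit_ratio"
  have \<alpha>: "\<alpha> \<noteq> 0" using digit_ratio_nonzero by (simp add: \<alpha>_def)
  \<comment> \<open>This is the solution of \<open>(1 + (2 + \<theta>) \<eta>) q = (1 + q) / 2\<close>.\<close>
  define \<eta> where "\<eta> = (1 - q) / (2 * q * (2 + \<theta>))"
  have \<eta>: "\<eta> > 0" using q \<theta> by (simp add: \<eta>_def)
  define r where "r = (1 + q) / 2"
  have r: "0 < r" "r < 1" using q by (auto simp: r_def)
  have "(2 + \<theta>) * \<eta> = (1 - q) / (2 * q)"
    using \<theta> by (simp add: \<eta>_def)
  then have r_eq: "(1 + (2 + \<theta>) * \<eta>) * q = r"
    using q(1) by (simp add: r_def field_simps)
  define \<delta> where "\<delta> = 1 / (4 * (1 + \<theta>))"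
  have \<delta>: "0 < \<delta>" "\<delta> \<le> 1 / 2" "\<delta> * (1 + \<theta>) < 1 / 2"
    using \<theta> by (auto simp: \<delta>_def field_simps)
  obtain \<eta>0 where \<eta>0: "0 \<le> \<eta>0" "\<eta>0 < 1"
    "\<And>t. \<bar>\<alpha> * t - round (\<alpha> * t)\<bar> \<ge> \<delta> \<Longrightarrow> norm (mask t) \<le> \<eta>0"
    using mask_bound_off_lattice[OF \<delta>(1,2)] unfolding \<alpha>_def by blast
  obtain Q0 where Q0: "\<eta>0 ^ Q0 < \<eta>"
    using real_arch_pow_inv[OF \<eta> \<eta>0(2)] by blast
  define Q where "Q = Suc Q0"
  have Q: "\<eta>0 ^ Q \<le> \<eta>" "Q \<ge> 1"
    using Q0 \<eta>0 mult_left_le_one_le[of "\<eta>0 ^ Q0" \<eta>0] by (auto simp: Q_def)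
  define s where "s = sqrt r"
  have s: "0 < s" "s < 1" "s * s = r"
    using r by (auto simp: s_def)
  \<comment> \<open>The threshold \<open>\<gamma> ^ l\<close> for Markov's inequality turns the decay rate \<open>r\<close> of the moment into \<open>r / s = s\<close>.\<close>
  define \<gamma> where "\<gamma> = root (2 * Q) s"
  have \<gamma>: "0 < \<gamma>" "\<gamma> < 1" "\<gamma> ^ (2 * Q) = s"
    using s Q by (auto simp: \<gamma>_def real_root_pow_pos2 simp del: power_mult)
  define W where "W = 2 / (\<bar>\<alpha>\<bar> * b)"
  have W: "W > 0" using \<alpha> b by (simp add: W_def)
  obtain Cf where Cf: "Cf > 0" "\<And>l u v. v - u \<le> W * \<rho> ^ l \<Longrightarrow> measure \<mu> {u..v} \<le> Cf * q ^ l"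
    using q(3)[OF W] by blast
  define R where "R = \<bar>\<alpha>\<bar> * \<Lambda> * B"
  have R: "R \<ge> 0" using B \<Lambda> by (simp add: R_def)
  define C1 where "C1 = (2 * R + 2) * Cf"
  have C1: "C1 \<ge> 0" using R Cf by (simp add: C1_def)
  define \<sigma> where "\<sigma> = max \<gamma> s"
  have "(\<integral>x. norm (char \<mu> (T * \<psi> x)) \<partial>\<mu>) \<le> (1 + C1) * \<sigma> ^ l"
    if T: "1 \<le> \<bar>T\<bar> * \<rho> ^ l" "\<bar>T\<bar> * \<rho> ^ l \<le> \<Lambda>" for l T
  proof -
    \<comment> \<open>The frequencies are read from the lowest one upwards, so that \<open>\<theta> ^ k * X x\<close> runs through an expanding orbit.\<close>
    define X where "X x = \<alpha> * T * \<rho> ^ l * \<psi> x" for x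
    define g where "g u = norm (mask (u / \<alpha>)) ^ Q" for u
    define F where "F x = (\<Prod>k\<le>l. norm (mask (\<rho> ^ k * (T * \<psi> x))))" for x
    have [measurable]: "X \<in> borel_measurable \<mu>"
      unfolding X_def by measurable
    have F01: "0 \<le> F x" "F x \<le> 1" for x
      unfolding F_def using norm_mask_le_1 by (auto intro: prod_nonneg prod_le_1)
    have F_pow: "F x ^ (2 * Q) = (\<Prod>k\<le>l. (g (\<theta> ^ k * X x))\<^sup>2)" for x
    proof -
      have "F x = (\<Prod>k\<le>l. norm (mask (\<rho> ^ (l - k) * (T * \<psi> x))))"
        unfolding F_def by (rule prod.nat_diff_reindex[of _ "Suc l", unfolded lessThan_Suc_atMost, simplified, symmetric])
      also have "\<dots> = (\<Prod>k\<le>l. norm (mask (\<theta> ^ k * X x / \<alpha>)))"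
      proof (rule prod.cong)
        fix k assume "k \<in> {..l}"
        then have "\<rho> ^ l = \<rho> ^ (l - k) * \<rho> ^ k" by (simp flip: power_add)
        then have "\<theta> ^ k * X x / \<alpha> = \<rho> ^ (l - k) * (T * \<psi> x)"
          using \<alpha> \<rho> by (simp add: X_def \<theta>_def power_one_over)
        then show "norm (mask (\<rho> ^ (l - k) * (T * \<psi> x))) = norm (mask (\<theta> ^ k * X x / \<alpha>))" by simp
      qed simp
      finally have "F x ^ (2 * Q) = (\<Prod>k\<le>l. norm (mask (\<theta> ^ k * X x / \<alpha>)) ^ (2 * Q))"
        by (simp only: prod_power_distrib)
      then show ?thesis
        by (simp add: g_def mult.commute flip: power_mult)
    qed
    have "(\<integral>\<^sup>+x. ennreal (\<Prod>k\<le>l. (g (\<theta> ^ k * X x))\<^sup>2) \<partial>\<mu>)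
        \<le> ennreal ((2 * R + 2) * (1 + (2 + \<theta>) * \<eta>) ^ l * (Cf * q ^ l))"
    proof (rule erdos_kahane_integral[OF _ \<theta> \<delta>(3)])
      show "0 \<le> g u" "g u \<le> 1" for u
        using norm_mask_le_1 by (auto simp: g_def intro: power_le_one)
      show "g u \<le> \<eta>" if "\<bar>u - round u\<bar> \<ge> \<delta>" for u :: real
      proof -
        have "norm (mask (u / \<alpha>)) ^ Q \<le> \<eta>0 ^ Q"
          using \<eta>0(3)[of "u / \<alpha>"] that \<alpha> by (intro power_mono) auto
        with Q show ?thesis unfolding g_def by linarith
      qed
      show "AE x in \<mu>. \<bar>X x\<bar> \<le> R"
        using AE_K
      proof eventually_elim
        case (elim x)
        have "\<bar>X x\<bar> = \<bar>\<alpha>\<bar> * (\<bar>T\<bar> * \<rho> ^ l) * \<bar>\<psi> x\<bar>"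
          using \<rho> by (simp add: X_def abs_mult)
        also have "\<dots> \<le> \<bar>\<alpha>\<bar> * \<Lambda> * B"
          using T B elim \<Lambda> by (intro mult_mono mult_left_mono) (auto intro: order_trans)
        finally show ?case by (simp add: R_def)
      qed
      show "emeasure \<mu> {x \<in> space \<mu>. round (\<theta> ^ l * X x) = i} \<le> ennreal (Cf * q ^ l)" for i
      proof -
        let ?S = "{x. round (\<theta> ^ l * X x) = i}"
        have \<theta>X: "\<theta> ^ l * X x = \<alpha> * T * \<psi> x" for x
          using \<rho> by (simp add: X_def \<theta>_def power_one_over)
        have meas_S [measurable]: "?S \<in> sets borel"
          unfolding \<theta>X round_def by measurable
        have "measure \<mu> ?S \<le> Cf * q ^ l"
        proof (cases "?S \<inter> K = {}")
          case True
          have "AE x in \<mu>. x \<notin> ?S"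
            using AE_K by eventually_elim (use True in auto)
          then have "measure \<mu> ?S = measure \<mu> {}"
            using meas_S by (intro measure_eq_AE) auto
          then show ?thesis using Cf q by simp
        next
          case False
          then obtain z where z: "z \<in> K" "z \<in> ?S" by auto
          have T0: "T \<noteq> 0" using T by auto
          define w where "w = 1 / (\<bar>\<alpha>\<bar> * \<bar>T\<bar> * b)"
          have sub: "x \<in> {z - w..z + w}" if x: "x \<in> ?S" "x \<in> K" for x
          proof -
            have "round (\<alpha> * T * \<psi> x) = i" "round (\<alpha> * T * \<psi> z) = i"
              using x z by (auto simp: \<theta>X)
            then have "\<bar>\<alpha> * T * \<psi> x - \<alpha> * T * \<psi> z\<bar> \<le> 1"
              using of_int_round_abs_le[of "\<alpha> * T * \<psi> x"] of_int_round_abs_le[of "\<alpha> * T * \<psi> z"]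
              by linarith
            then have "\<bar>\<alpha>\<bar> * \<bar>T\<bar> * \<bar>\<psi> x - \<psi> z\<bar> \<le> 1"
              by (simp flip: abs_mult right_diff_distrib)
            moreover have "\<bar>\<alpha>\<bar> * \<bar>T\<bar> * (b * \<bar>x - z\<bar>) \<le> \<bar>\<alpha>\<bar> * \<bar>T\<bar> * \<bar>\<psi> x - \<psi> z\<bar>"
              using expand[OF x(2) z(1)] by (intro mult_left_mono) auto
            ultimately have "\<bar>x - z\<bar> * (\<bar>\<alpha>\<bar> * \<bar>T\<bar> * b) \<le> 1"
              by (simp add: mult_ac)
            then have "\<bar>x - z\<bar> \<le> w"
              unfolding w_def using \<alpha> T0 b by (subst pos_le_divide_eq) auto
            then show ?thesis by auto
          qed
          have "measure \<mu> ?S \<le> measure \<mu> {z - w..z + w}"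
          proof (rule finite_measure_mono_AE)
            show "AE x in \<mu>. x \<in> ?S \<longrightarrow> x \<in> {z - w..z + w}"
              using AE_K by eventually_elim (use sub in blast)
          qed simp
          also have "\<dots> \<le> Cf * q ^ l"
          proof (rule Cf(2))
            have "(z + w) - (z - w) = W * (1 / \<bar>T\<bar>)"
              by (simp add: w_def W_def)
            also have "1 / \<bar>T\<bar> \<le> \<rho> ^ l"
              using T T0 by (simp add: field_simps)
            finally show "(z + w) - (z - w) \<le> W * \<rho> ^ l"
              using W by simp
          qed
          finally show ?thesis .
        qed
        then show ?thesis
          by (simp add: emeasure_eq_measure ennreal_leI)
      qed
    qed (use R \<eta> Cf q in auto)
    also have "(2 * R + 2) * (1 + (2 + \<theta>) * \<eta>) ^ l * (Cf * q ^ l) = C1 * r ^ l"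
      by (simp add: C1_def mult_ac flip: r_eq power_mult_distrib)
    finally have moment: "(\<integral>\<^sup>+x. ennreal (F x ^ (2 * Q)) \<partial>\<mu>) \<le> ennreal (C1 * r ^ l)"
      by (simp only: F_pow)
    have markov: "norm (char \<mu> (T * \<psi> x)) \<le> \<gamma> ^ l + F x ^ (2 * Q) / s ^ l" for x
    proof -
      have "norm (char \<mu> (T * \<psi> x)) \<le> F x"
        using norm_char_le_prod[of "T * \<psi> x" "Suc l"] by (simp only: F_def lessThan_Suc_atMost)
      also have "F x \<le> \<gamma> ^ l + F x ^ (2 * Q) / s ^ l"
      proof (cases "F x \<le> \<gamma> ^ l")
        case True
        have "0 \<le> F x ^ (2 * Q) / s ^ l" using F01(1) s by simp
        with True show ?thesis by linarith
      next
        case False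
        have "s ^ l = (\<gamma> ^ l) ^ (2 * Q)"
          by (metis \<gamma>(3) mult.commute power_mult)
        also have "\<dots> \<le> F x ^ (2 * Q)"
          using False \<gamma> by (intro power_mono) auto
        finally have "1 \<le> F x ^ (2 * Q) / s ^ l"
          using s by simp
        moreover have "\<gamma> ^ l \<ge> 0" using \<gamma> by simp
        ultimately show ?thesis using F01(2)[of x] by linarith
      qed
      finally show ?thesis .
    qed
    have int: "integrable \<mu> (\<lambda>x. norm (char \<mu> (T * \<psi> x)))"
      using cmod_char_le_1 by (intro integrable_const_bound[where B = 1]) auto
    have meas_F [measurable]: "F \<in> borel_measurable \<mu>"
      unfolding F_def mask_def by measurable
    have "ennreal (\<integral>x. norm (char \<mu> (T * \<psi> x)) \<partial>\<mu>) = (\<integral>\<^sup>+x. ennreal (norm (char \<mu> (T * \<psi> x))) \<partial>\<mu>)"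
      using int by (intro nn_integral_eq_integral[symmetric]) auto
    also have "\<dots> \<le> (\<integral>\<^sup>+x. ennreal (\<gamma> ^ l) + ennreal (1 / s ^ l) * ennreal (F x ^ (2 * Q)) \<partial>\<mu>)"
    proof (rule nn_integral_mono)
      fix x
      have "ennreal (norm (char \<mu> (T * \<psi> x))) \<le> ennreal (\<gamma> ^ l + 1 / s ^ l * F x ^ (2 * Q))"
        using markov[of x] by (intro ennreal_leI) simp
      also have "\<dots> = ennreal (\<gamma> ^ l) + ennreal (1 / s ^ l) * ennreal (F x ^ (2 * Q))"
        using \<gamma> s F01(1) by (simp add: ennreal_plus ennreal_mult del: times_divide_eq_left)
      finally show "ennreal (norm (char \<mu> (T * \<psi> x))) \<le> ennreal (\<gamma> ^ l) + ennreal (1 / s ^ l) * ennreal (F x ^ (2 * Q))" .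
    qed
    also have "\<dots> = ennreal (\<gamma> ^ l) + ennreal (1 / s ^ l) * (\<integral>\<^sup>+x. ennreal (F x ^ (2 * Q)) \<partial>\<mu>)"
      using emeasure_space_1 by (simp add: nn_integral_add nn_integral_cmult)
    also have "\<dots> \<le> ennreal (\<gamma> ^ l) + ennreal (1 / s ^ l) * ennreal (C1 * r ^ l)"
      by (intro add_left_mono mult_left_mono moment) auto
    also have "\<dots> = ennreal (\<gamma> ^ l + 1 / s ^ l * (C1 * r ^ l))"
      using \<gamma> s r C1 by (simp add: ennreal_plus ennreal_mult del: times_divide_eq_left)
    finally have "(\<integral>x. norm (char \<mu> (T * \<psi> x)) \<partial>\<mu>) \<le> \<gamma> ^ l + 1 / s ^ l * (C1 * r ^ l)"
      using \<gamma> s r C1 by (subst (asm) ennreal_le_iff) auto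
    also have "1 / s ^ l * (C1 * r ^ l) = C1 * s ^ l"
      using s by (simp add: power_mult_distrib flip: s(3))
    also have "\<gamma> ^ l + C1 * s ^ l \<le> \<sigma> ^ l + C1 * \<sigma> ^ l"
      using \<gamma> s C1 by (intro add_mono mult_left_mono power_mono) (auto simp: \<sigma>_def)
    finally show ?thesis by (simp add: distrib_right)
  qed
  moreover have "0 < \<sigma>" "\<sigma> < 1" using \<gamma> s by (auto simp: \<sigma>_def)
  ultimately show thesis using C1 that[of "1 + C1" \<sigma>] by auto
qed

end

section \<open>Fourier decay of convex images and equidistribution\<close>

lemma mean_value_between:
  fixes f f' :: "real \<Rightarrow> real"
  assumes "\<And>x. (f has_real_derivative f' x) (at x)"
  obtains c where "min w z \<le> c" "c \<le> max w z" "f w - f z = f' c * (w - z)"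
proof -
  consider "w = z" | "w < z" | "z < w" by linarith
  then show thesis
  proof cases
    case 1
    then show thesis by (intro that[of z]) auto
  next
    case 2
    then obtain c where "w < c" "c < z" "f z - f w = (z - w) * f' c"
      using MVT2[of w z f f'] assms by auto
    with 2 show thesis by (intro that[of c]) (auto simp: algebra_simps)
  next
    case 3
    then obtain c where "z < c" "c < w" "f w - f z = (w - z) * f' c"
      using MVT2[of z w f f'] assms by auto
    with 3 show thesis by (intro that[of c]) (auto simp: algebra_simps)
  qed
qed

lemma norm_iexp_diff_le: "norm (iexp u - iexp v) \<le> \<bar>u - v\<bar>"
proof -
  have "iexp u - iexp v = iexp v * (iexp (u - v) - 1)"
    by (simp add: right_diff_distrib algebra_simps flip: exp_add)
  then have "norm (iexp u - iexp v) = norm (iexp (u - v) - 1)"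
    by (simp add: norm_mult)
  also have "\<dots> \<le> \<bar>u - v\<bar>"
    using iexp_approx1[of "u - v" 0] by simp
  finally show ?thesis .
qed

lemma power_bracket:
  fixes \<Theta> u :: real
  assumes "\<Theta> > 1" "u \<ge> 1"
  obtains l where "\<Theta> ^ l \<le> u" "u < \<Theta> ^ Suc l"
proof -
  define l where "l = nat \<lfloor>log \<Theta> u\<rfloor>"
  have log0: "0 \<le> log \<Theta> u" using assms by simp
  then have "real l \<le> log \<Theta> u" "log \<Theta> u < real (Suc l)"
    by (auto simp: l_def) linarith
  then have "\<Theta> powr real l \<le> u" "u < \<Theta> powr real (Suc l)"
    using assms by (auto simp: le_log_iff log_less_iff simp del: of_nat_Suc)
  then show thesis
    using assms that[of l] by (simp add: powr_realpow del: of_nat_Suc)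
qed

lemma power_powr_commute:
  fixes u v :: real
  assumes "u > 0"
  shows "(u ^ k) powr v = (u powr v) ^ k"
  using assms by (induction k) (simp_all add: powr_mult)

context separated_self_similar_measure begin

text \<open>
  On a cylinder \<open>y + \<rho>\<^sup>n K\<close> replace \<open>\<phi>\<close> by its tangent at any of its points \<open>z\<close>: the integral becomes a
  value of the Fourier transform of \<open>\<mu>\<close> times a number of modulus \<open>1\<close>. Averaging the resulting bound
  over \<open>z\<close> in the cylinder turns it into an integral against \<open>\<mu>\<close>, as the comparison of cylinders
  requires.
\<close>

lemma fourier_linearization:
  fixes \<phi> \<phi>' :: "real \<Rightarrow> real"
  assumes [measurable]: "\<phi> \<in> borel_measurable borel" "\<phi>' \<in> borel_measurable borel"
    and taylor: "\<And>w z. w \<in> K \<Longrightarrow> z \<in> K \<Longrightarrow> \<bar>\<phi> w - \<phi> z - \<phi>' z * (w - z)\<bar> \<le> A * (w - z)\<^sup>2"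
    and A: "A \<ge> 0" and D: "\<And>w z. w \<in> K \<Longrightarrow> z \<in> K \<Longrightarrow> \<bar>w - z\<bar> \<le> D"
  shows "norm (\<integral>x. iexp (\<xi> * \<phi> x) \<partial>\<mu>)
      \<le> (\<integral>z. norm (char \<mu> (\<xi> * \<rho> ^ n * \<phi>' z)) \<partial>\<mu>) + \<bar>\<xi>\<bar> * A * (\<rho> ^ n * D)\<^sup>2"
proof -
  define E where "E = \<bar>\<xi>\<bar> * A * (\<rho> ^ n * D)\<^sup>2"
  have E: "E \<ge> 0" using A by (simp add: E_def)
  define F where "F z = norm (char \<mu> (\<xi> * \<rho> ^ n * \<phi>' z)) + E" for z
  have [measurable]: "F \<in> borel_measurable borel"
    unfolding F_def by measurable
  have F_bound: "\<bar>F z\<bar> \<le> 1 + E" for z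
    using cmod_char_le_1 E by (simp add: F_def)
  have intF: "integrable \<mu> (\<lambda>x. F (f x))" if [measurable]: "f \<in> borel_measurable borel" for f
    using F_bound by (intro integrable_const_bound[where B = "1 + E"]) auto
  have "norm (\<integral>x. iexp (\<xi> * \<phi> x) \<partial>\<mu>) \<le> (\<integral>z. F z \<partial>\<mu>)"
  proof (rule norm_integral_le_by_cylinders[where B = "1 + E" and n = n])
    fix y assume y: "\<And>x. x \<in> K \<Longrightarrow> y + \<rho> ^ n * x \<in> K"
    have pointwise: "norm (\<integral>x. iexp (\<xi> * \<phi> (y + \<rho> ^ n * x)) \<partial>\<mu>) \<le> F (y + \<rho> ^ n * x')" if x': "x' \<in> K" for x'
    proof -
      define z where "z = y + \<rho> ^ n * x'"
      define G where "G x = iexp (\<xi> * \<phi> (y + \<rho> ^ n * x))" for x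
      define L where "L x = iexp (\<xi> * (\<phi> z - \<phi>' z * \<rho> ^ n * x')) * iexp ((\<xi> * \<rho> ^ n * \<phi>' z) * x)" for x
      have [measurable]: "G \<in> borel_measurable borel" "L \<in> borel_measurable borel"
        unfolding G_def L_def by measurable
      have int: "integrable \<mu> G" "integrable \<mu> L"
        by (auto intro!: integrable_const_bound[where B = 1] simp: G_def L_def norm_mult)
      have "norm (\<integral>x. L x \<partial>\<mu>) = norm (char \<mu> (\<xi> * \<rho> ^ n * \<phi>' z))"
        unfolding L_def char_def by (simp add: norm_mult)
      moreover have "norm ((\<integral>x. G x \<partial>\<mu>) - (\<integral>x. L x \<partial>\<mu>)) \<le> E"
      proof -
        have "(\<integral>x. G x \<partial>\<mu>) - (\<integral>x. L x \<partial>\<mu>) = (\<integral>x. G x - L x \<partial>\<mu>)"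
          using int by (rule Bochner_Integration.integral_diff[symmetric])
        also have "norm \<dots> \<le> (\<integral>x. norm (G x - L x) \<partial>\<mu>)"
          by (rule integral_norm_bound)
        also have "\<dots> \<le> E"
        proof (rule integral_le_const)
          show "integrable \<mu> (\<lambda>x. norm (G x - L x))" using int by auto
          show "AE x in \<mu>. norm (G x - L x) \<le> E"
            using AE_K
          proof eventually_elim
            case (elim x)
            define w where "w = y + \<rho> ^ n * x"
            have wz: "w \<in> K" "z \<in> K" "w - z = \<rho> ^ n * (x - x')"
              using y elim x' by (auto simp: w_def z_def algebra_simps)
            have "L x = iexp (\<xi> * (\<phi> z + \<phi>' z * (w - z)))"
              unfolding L_def wz(3) by (simp add: algebra_simps flip: exp_add)
            then have "norm (G x - L x) \<le> \<bar>\<xi> * \<phi> w - \<xi> * (\<phi> z + \<phi>' z * (w - z))\<bar>"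
              unfolding G_def w_def[symmetric] by (simp only: norm_iexp_diff_le)
            also have "\<dots> = \<bar>\<xi>\<bar> * \<bar>\<phi> w - \<phi> z - \<phi>' z * (w - z)\<bar>"
              by (simp add: algebra_simps flip: abs_mult)
            also have "\<dots> \<le> \<bar>\<xi>\<bar> * (A * (w - z)\<^sup>2)"
              by (intro mult_left_mono taylor wz(1,2)) simp
            also have "\<dots> \<le> \<bar>\<xi>\<bar> * (A * (\<rho> ^ n * D)\<^sup>2)"
            proof (intro mult_left_mono A)
              have "\<bar>w - z\<bar> = \<rho> ^ n * \<bar>x - x'\<bar>"
                using \<rho> by (simp add: wz(3) abs_mult)
              also have "\<dots> \<le> \<rho> ^ n * D"
                using D elim x' \<rho> by (intro mult_left_mono) auto
              finally show "(w - z)\<^sup>2 \<le> (\<rho> ^ n * D)\<^sup>2"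
                by (metis abs_ge_zero power2_abs power_mono)
            qed auto
            finally show ?case by (simp add: E_def mult.assoc)
          qed
        qed
        finally show ?thesis .
      qed
      ultimately have "norm (\<integral>x. G x \<partial>\<mu>) \<le> norm (char \<mu> (\<xi> * \<rho> ^ n * \<phi>' z)) + E"
        using norm_triangle_ineq2[of "\<integral>x. G x \<partial>\<mu>" "\<integral>x. L x \<partial>\<mu>"] by linarith
      then show ?thesis by (simp add: F_def z_def G_def)
    qed
    have "AE x' in \<mu>. norm (\<integral>x. iexp (\<xi> * \<phi> (y + \<rho> ^ n * x)) \<partial>\<mu>) \<le> F (y + \<rho> ^ n * x')"
      using AE_K by eventually_elim (rule pointwise)
    then show "norm (\<integral>x. iexp (\<xi> * \<phi> (y + \<rho> ^ n * x)) \<partial>\<mu>) \<le> (\<integral>x'. F (y + \<rho> ^ n * x') \<partial>\<mu>)"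
      by (intro integral_ge_const intF) auto
  qed (use F_bound E in auto)
  also have "(\<integral>z. F z \<partial>\<mu>) = (\<integral>z. norm (char \<mu> (\<xi> * \<rho> ^ n * \<phi>' z)) \<partial>\<mu>) + E"
    unfolding F_def using cmod_char_le_1
    by (subst Bochner_Integration.integral_add)
      (auto intro!: integrable_const_bound[where B = 1] simp: prob_UNIV)
  finally show ?thesis by (simp add: E_def)
qed

text \<open>
  With \<open>\<bar>\<xi>\<bar>\<close> comparable to \<open>\<rho>\<^sup>-\<^sup>3\<^sup>l\<close>, cylinders of generation \<open>2 l\<close> balance the two errors: linearization
  costs \<open>\<bar>\<xi>\<bar> \<rho>\<^sup>4\<^sup>l\<close>, about \<open>\<rho>\<^sup>l\<close>, and the remaining frequency \<open>\<bar>\<xi>\<bar> \<rho>\<^sup>2\<^sup>l\<close> is about \<open>\<rho>\<^sup>-\<^sup>l\<close>, which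
  leaves \<open>l\<close> factors of the mask to gain from.
\<close>

theorem fourier_decay_of_image:
  fixes \<phi> :: "real \<Rightarrow> real"
  assumes \<phi>: "C2 \<phi>" and convex: "\<And>x. deriv (deriv \<phi>) x > 0"
  obtains C \<tau> where "C \<ge> 0" "\<tau> > 0"
    "\<And>\<xi>. 1 \<le> \<bar>\<xi>\<bar> \<Longrightarrow> norm (\<integral>x. iexp (\<xi> * \<phi> x) \<partial>\<mu>) \<le> C * \<bar>\<xi>\<bar> powr - \<tau>"
proof -
  have der1: "(\<phi> has_real_derivative deriv \<phi> x) (at x)"
    and der2: "(deriv \<phi> has_real_derivative deriv (deriv \<phi>) x) (at x)" for x
    using \<phi> by (auto simp: C2_def differentiable_on_def DERIV_deriv_iff_real_differentiable)
  have cont: "continuous_on S \<phi>" "continuous_on S (deriv \<phi>)" for S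
    using der1 der2 by (meson DERIV_isCont continuous_at_imp_continuous_on)+
  have [measurable]: "\<phi> \<in> borel_measurable borel" "deriv \<phi> \<in> borel_measurable borel"
    by (intro borel_measurable_continuous_onI cont)+
  have cont2: "continuous_on S (deriv (deriv \<phi>))" for S
    using \<phi> continuous_on_subset by (auto simp: C2_def)
  obtain R where R: "\<And>x. x \<in> K \<Longrightarrow> \<bar>x\<bar> \<le> R"
    using compact_imp_bounded[OF K(2)] by (auto simp: bounded_iff)
  define S where "S = {- R..R}"
  have KS: "x \<in> S" if "x \<in> K" for x
    using R[OF that] by (auto simp: S_def)
  then have "S \<noteq> {}" using K(1) by blast
  moreover have "compact S" by (simp add: S_def)
  ultimately have S: "compact S" "S \<noteq> {}" by auto
  \<comment> \<open>Strict convexity becomes uniform on an interval that contains \<open>K\<close>.\<close>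
  obtain x0 where x0: "\<And>x. x \<in> S \<Longrightarrow> deriv (deriv \<phi>) x0 \<le> deriv (deriv \<phi>) x"
    using continuous_attains_inf[OF S cont2] by blast
  obtain x1 where x1: "\<And>x. x \<in> S \<Longrightarrow> deriv (deriv \<phi>) x \<le> deriv (deriv \<phi>) x1"
    using continuous_attains_sup[OF S cont2] by blast
  obtain B where B: "\<And>x. x \<in> S \<Longrightarrow> \<bar>deriv \<phi> x\<bar> \<le> B"
    using compact_imp_bounded[OF compact_continuous_image[OF cont(2) S(1)]] by (auto simp: bounded_iff)
  define b where "b = deriv (deriv \<phi>) x0"
  define A where "A = deriv (deriv \<phi>) x1"
  have b: "b > 0" and A: "A > 0" using convex by (auto simp: b_def A_def)
  have between: "c \<in> S" if "min w z \<le> c" "c \<le> max w z" "w \<in> S" "z \<in> S" for c w z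
    using that by (auto simp: S_def)
  have lip: "b * \<bar>w - z\<bar> \<le> \<bar>deriv \<phi> w - deriv \<phi> z\<bar>" "\<bar>deriv \<phi> w - deriv \<phi> z\<bar> \<le> A * \<bar>w - z\<bar>"
    if wz: "w \<in> S" "z \<in> S" for w z
  proof -
    obtain c where c: "min w z \<le> c" "c \<le> max w z" "deriv \<phi> w - deriv \<phi> z = deriv (deriv \<phi>) c * (w - z)"
      using mean_value_between[OF der2] by blast
    have "c \<in> S" using between c wz by blast
    then have "b \<le> deriv (deriv \<phi>) c" "deriv (deriv \<phi>) c \<le> A"
      using x0 x1 by (auto simp: b_def A_def)
    moreover have "\<bar>deriv \<phi> w - deriv \<phi> z\<bar> = deriv (deriv \<phi>) c * \<bar>w - z\<bar>"
      using convex[of c] by (simp add: c(3) abs_mult)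
    ultimately show "b * \<bar>w - z\<bar> \<le> \<bar>deriv \<phi> w - deriv \<phi> z\<bar>" "\<bar>deriv \<phi> w - deriv \<phi> z\<bar> \<le> A * \<bar>w - z\<bar>"
      by (auto intro: mult_right_mono)
  qed
  have taylor: "\<bar>\<phi> w - \<phi> z - deriv \<phi> z * (w - z)\<bar> \<le> A * (w - z)\<^sup>2" if wz: "w \<in> S" "z \<in> S" for w z
  proof -
    obtain c where c: "min w z \<le> c" "c \<le> max w z" "\<phi> w - \<phi> z = deriv \<phi> c * (w - z)"
      using mean_value_between[OF der1] by blast
    have "c \<in> S" using between c wz by blast
    have "\<bar>\<phi> w - \<phi> z - deriv \<phi> z * (w - z)\<bar> = \<bar>deriv \<phi> c - deriv \<phi> z\<bar> * \<bar>w - z\<bar>"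
      by (simp add: c(3) left_diff_distrib flip: abs_mult)
    also have "\<dots> \<le> (A * \<bar>c - z\<bar>) * \<bar>w - z\<bar>"
      using lip(2)[OF \<open>c \<in> S\<close> wz(2)] by (intro mult_right_mono) auto
    also have "\<dots> \<le> (A * \<bar>w - z\<bar>) * \<bar>w - z\<bar>"
      using c A by (intro mult_right_mono mult_left_mono) auto
    also have "\<dots> = A * (w - z)\<^sup>2"
      by (simp add: power2_eq_square abs_mult_self_eq mult.assoc)
    finally show ?thesis .
  qed
  define \<theta> where "\<theta> = 1 / \<rho>"
  have \<theta>: "\<theta> > 1" using \<rho> by (simp add: \<theta>_def)
  have \<theta>\<rho>: "\<theta> ^ k * \<rho> ^ k = 1" for k
    using \<rho> by (simp add: \<theta>_def flip: power_mult_distrib)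
  obtain C1 \<sigma>1 where C1: "C1 \<ge> 0" "0 < \<sigma>1" "\<sigma>1 < 1"
    "\<And>l T. 1 \<le> \<bar>T\<bar> * \<rho> ^ l \<Longrightarrow> \<bar>T\<bar> * \<rho> ^ l \<le> \<theta> ^ 3 \<Longrightarrow>
      (\<integral>x. norm (char \<mu> (T * deriv \<phi> x)) \<partial>\<mu>) \<le> C1 * \<sigma>1 ^ l"
  proof (rule char_average_decay[of "deriv \<phi>" b B "\<theta> ^ 3"])
    obtain x where "x \<in> S" using S by auto
    then show "0 \<le> B" using B[of x] by linarith
  qed (use b lip(1) KS B \<theta> in auto)
  define \<sigma> where "\<sigma> = max \<sigma>1 \<rho>"
  have \<sigma>: "0 < \<sigma>" "\<sigma> < 1" "\<sigma>1 \<le> \<sigma>" "\<rho> \<le> \<sigma>" using C1 \<rho> by (auto simp: \<sigma>_def)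
  define C' where "C' = C1 + \<theta> ^ 3 * (A * (2 * R)\<^sup>2)"
  have C': "C' \<ge> 0" using C1 \<theta> A by (simp add: C'_def)
  have \<theta>3: "\<theta> ^ 3 > 1" using \<theta> by (simp add: one_less_power)
  define L where "L = ln (\<theta> ^ 3)"
  have L: "L > 0" unfolding L_def by (rule ln_gt_zero[OF \<theta>3])
  \<comment> \<open>The exponent for which \<open>(\<theta> ^ 3) powr - \<tau> = \<sigma>\<close>.\<close>
  define \<tau> where "\<tau> = - ln \<sigma> / L"
  have \<tau>: "\<tau> > 0" using \<sigma> L unfolding \<tau>_def by (intro divide_pos_pos) auto
  have "(\<theta> ^ 3) powr - \<tau> = exp (- \<tau> * L)"
    using \<theta> by (simp add: powr_def L_def)
  also have "- \<tau> * L = ln \<sigma>"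
    using L by (simp add: \<tau>_def)
  finally have \<theta>3_powr: "(\<theta> ^ 3) powr - \<tau> = \<sigma>"
    using \<sigma>(1) by simp
  show thesis
  proof (rule that[of "C' / \<sigma>" \<tau>])
    fix \<xi> :: real assume \<xi>: "1 \<le> \<bar>\<xi>\<bar>"
    obtain l where l: "(\<theta> ^ 3) ^ l \<le> \<bar>\<xi>\<bar>" "\<bar>\<xi>\<bar> < (\<theta> ^ 3) ^ Suc l"
      using power_bracket[OF \<theta>3 \<xi>] by blast
    have cube: "(\<theta> ^ 3) ^ l * (\<rho> ^ l) ^ 3 = 1"
    proof -
      have "(\<theta> ^ 3) ^ l = (\<theta> ^ l) ^ 3"
        by (simp only: power_mult[symmetric] mult.commute)
      then have "(\<theta> ^ 3) ^ l * (\<rho> ^ l) ^ 3 = (\<theta> ^ l * \<rho> ^ l) ^ 3"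
        by (simp only: power_mult_distrib)
      then show ?thesis
        by (simp only: \<theta>\<rho> power_one)
    qed
    have double: "\<rho> ^ (2 * l) = \<rho> ^ l * \<rho> ^ l"
      by (simp only: mult_2 power_add)
    have lower: "1 \<le> \<bar>\<xi>\<bar> * (\<rho> ^ l) ^ 3"
      using mult_right_mono[OF l(1), of "(\<rho> ^ l) ^ 3"] cube \<rho> by simp
    have upper: "\<bar>\<xi>\<bar> * (\<rho> ^ l) ^ 3 \<le> \<theta> ^ 3"
      using mult_right_mono[OF less_imp_le[OF l(2)], of "(\<rho> ^ l) ^ 3"] cube \<rho> by (simp add: mult.assoc)
    have T: "\<bar>\<xi> * \<rho> ^ (2 * l)\<bar> * \<rho> ^ l = \<bar>\<xi>\<bar> * (\<rho> ^ l) ^ 3"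
      unfolding double using \<rho> by (simp add: abs_mult power3_eq_cube)
    have "norm (\<integral>x. iexp (\<xi> * \<phi> x) \<partial>\<mu>) \<le> (\<integral>z. norm (char \<mu> (\<xi> * \<rho> ^ (2 * l) * deriv \<phi> z)) \<partial>\<mu>)
        + \<bar>\<xi>\<bar> * A * (\<rho> ^ (2 * l) * (2 * R))\<^sup>2"
    proof (rule fourier_linearization)
      show "\<bar>w - z\<bar> \<le> 2 * R" if "w \<in> K" "z \<in> K" for w z
        using R[OF that(1)] R[OF that(2)] by linarith
    qed (use taylor KS A in auto)
    also have "(\<integral>z. norm (char \<mu> (\<xi> * \<rho> ^ (2 * l) * deriv \<phi> z)) \<partial>\<mu>) \<le> C1 * \<sigma>1 ^ l"
      using lower upper unfolding T[symmetric] by (rule C1(4))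
    also have "\<bar>\<xi>\<bar> * A * (\<rho> ^ (2 * l) * (2 * R))\<^sup>2 = (\<bar>\<xi>\<bar> * (\<rho> ^ l) ^ 3) * (A * (2 * R)\<^sup>2) * \<rho> ^ l"
      unfolding double by (simp add: power2_eq_square power3_eq_cube)
    also have "\<dots> \<le> \<theta> ^ 3 * (A * (2 * R)\<^sup>2) * \<rho> ^ l"
      using upper A \<rho> by (intro mult_right_mono) auto
    also have "C1 * \<sigma>1 ^ l + \<theta> ^ 3 * (A * (2 * R)\<^sup>2) * \<rho> ^ l \<le> C1 * \<sigma> ^ l + \<theta> ^ 3 * (A * (2 * R)\<^sup>2) * \<sigma> ^ l"
      using C1 \<sigma> \<rho> \<theta> A by (intro add_mono mult_left_mono power_mono) auto
    also have "\<dots> = C' * \<sigma> ^ l"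
      by (simp add: C'_def distrib_right)
    also have "\<dots> = C' / \<sigma> * \<sigma> ^ Suc l"
      using \<sigma>(1) by simp
    also have "\<sigma> ^ Suc l = ((\<theta> ^ 3) ^ Suc l) powr - \<tau>"
      by (simp only: power_powr_commute[OF less_trans[OF zero_less_one \<theta>3]] \<theta>3_powr)
    also have "C' / \<sigma> * \<dots> \<le> C' / \<sigma> * \<bar>\<xi>\<bar> powr - \<tau>"
      using l \<xi> \<tau> C' \<sigma> by (intro mult_left_mono powr_mono2') auto
    finally show "norm (\<integral>x. iexp (\<xi> * \<phi> x) \<partial>\<mu>) \<le> C' / \<sigma> * \<bar>\<xi>\<bar> powr - \<tau>"
      by simp
  qed (use C' \<sigma> \<tau> in auto)
qed

theorem AE_equidistributed_image:
  fixes \<phi> :: "real \<Rightarrow> real" and s :: "nat \<Rightarrow> nat"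
  assumes \<phi>: "C2 \<phi>" and convex: "\<And>x. deriv (deriv \<phi>) x > 0" and s: "strict_mono_on {1..} s"
  shows "AE x in \<mu>. equidistributed_mod_1 (\<lambda>n. real (s n) * \<phi> x)"
proof -
  have "continuous_on UNIV \<phi>"
    using \<phi> by (auto simp: C2_def intro: differentiable_imp_continuous_on)
  then have [measurable]: "\<phi> \<in> borel_measurable borel"
    by (rule borel_measurable_continuous_onI)
  obtain C \<tau> where C: "C \<ge> 0" "\<tau> > 0"
    "\<And>\<xi>. 1 \<le> \<bar>\<xi>\<bar> \<Longrightarrow> norm (\<integral>x. iexp (\<xi> * \<phi> x) \<partial>\<mu>) \<le> C * \<bar>\<xi>\<bar> powr - \<tau>"
    using fourier_decay_of_image[OF \<phi> convex] by blast
  have s_gap: "real (n - k) \<le> real (s n) - real (s k)" if "1 \<le> k" "k < n" for k n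
  proof -
    have "s k + (n - k) \<le> s n" if "k \<le> n" for n
      using that
    proof (induction n rule: dec_induct)
      case (step n)
      then have "s n < s (Suc n)"
        using \<open>1 \<le> k\<close> by (intro strict_mono_onD[OF s]) auto
      with step show ?case by simp
    qed simp
    from this[of n] that show ?thesis by linarith
  qed
  have "AE x in \<mu>. (\<lambda>N. (\<Sum>n=1..N. cis (2 * pi * (h * (real (s n) * \<phi> x)))) / of_nat N) \<longlonglongrightarrow> 0"
    if h: "h \<noteq> 0" for h :: int
  proof (rule averages_tendsto_0_AE[OF _ _ C(1,2)])
    fix n k :: nat assume nk: "1 \<le> k" "k < n"
    define \<xi> where "\<xi> = 2 * pi * h * (real (s n) - real (s k))"
    have gap: "real (n - k) \<le> real (s n) - real (s k)" by (rule s_gap[OF nk])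
    have "1 * real (n - k) \<le> (2 * pi * \<bar>real_of_int h\<bar>) * (real (s n) - real (s k))"
    proof (rule mult_mono)
      have "1 \<le> \<bar>real_of_int h\<bar>" using h by linarith
      moreover have "2 * pi \<ge> 1" using pi_ge_two by linarith
      ultimately show "1 \<le> 2 * pi * \<bar>real_of_int h\<bar>"
        using mult_mono[of 1 "2 * pi" 1 "\<bar>real_of_int h\<bar>"] by simp
    qed (use gap in auto)
    also have "\<dots> = \<bar>\<xi>\<bar>"
      using gap nk by (simp add: \<xi>_def abs_mult)
    finally have \<xi>: "real (n - k) \<le> \<bar>\<xi>\<bar>" by simp
    have "cis (2 * pi * (h * (real (s n) * \<phi> x))) * cnj (cis (2 * pi * (h * (real (s k) * \<phi> x)))) = iexp (\<xi> * \<phi> x)" for x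
    proof -
      have "2 * pi * (h * (real (s n) * \<phi> x)) + - (2 * pi * (h * (real (s k) * \<phi> x))) = \<xi> * \<phi> x"
        by (simp add: \<xi>_def algebra_simps)
      then show ?thesis
        by (simp only: cis_cnj cis_mult) (simp only: cis_conv_exp)
    qed
    then have "norm (\<integral>x. cis (2 * pi * (h * (real (s n) * \<phi> x))) * cnj (cis (2 * pi * (h * (real (s k) * \<phi> x)))) \<partial>\<mu>)
        = norm (\<integral>x. iexp (\<xi> * \<phi> x) \<partial>\<mu>)"
      by simp
    also have "\<dots> \<le> C * \<bar>\<xi>\<bar> powr - \<tau>"
      using \<xi> nk by (intro C(3)) linarith
    also have "\<dots> \<le> C * real (n - k) powr - \<tau>"
      using \<xi> nk C by (intro mult_left_mono powr_mono2') auto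
    finally show "norm (\<integral>x. cis (2 * pi * (h * (real (s n) * \<phi> x))) * cnj (cis (2 * pi * (h * (real (s k) * \<phi> x)))) \<partial>\<mu>)
        \<le> C * real (n - k) powr - \<tau>" .
  next
    show "(\<lambda>x. cis (2 * pi * (h * (real (s n) * \<phi> x)))) \<in> borel_measurable \<mu>" for n
      unfolding cis_conv_exp by measurable
  qed simp
  then have "AE x in \<mu>. \<forall>h::int. h \<noteq> 0 \<longrightarrow>
      (\<lambda>N. (\<Sum>n=1..N. cis (2 * pi * (h * (real (s n) * \<phi> x)))) / of_nat N) \<longlonglongrightarrow> 0"
    by (subst AE_all_countable) auto
  then show ?thesis
    by eventually_elim (auto intro: weyl_criterion)
qed

end

theorem corollary1p4:
  fixes m :: nat and \<rho> :: real and a p :: "nat \<Rightarrow> real"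
    and K :: "real set" and \<mu> :: "real measure" and \<phi> :: "real \<Rightarrow> real"
  assumes "m \<ge> 2" and "0 < \<rho>" and "\<rho> < 1"
    and "is_attractor m (homogeneous_ifs \<rho> a) K"
    and "strong_separation m (homogeneous_ifs \<rho> a) K"
    and "positive_probability_vector m p"
    and "self_similar_measure m (homogeneous_ifs \<rho> a) p K \<mu>"
    and "C2 \<phi>" and "\<And>x. deriv (deriv \<phi>) x > 0"
  shows "(\<forall>s :: nat \<Rightarrow> nat. strict_mono_on {1..} s \<and> (\<forall>n\<ge>1. s n > 0) \<longrightarrow>
            (AE x in \<mu>. equidistributed_mod_1 (\<lambda>n. real (s n) * \<phi> x)))
       \<and> (AE x in \<mu>. \<forall>b::nat. b > 1 \<longrightarrow> normal_in_base b (\<phi> x))"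
proof -
  interpret separated_self_similar_measure m \<rho> a p K \<mu>
    by unfold_locales (use assms in auto)
  note equi = AE_equidistributed_image[OF assms(8,9)]
  have "AE x in \<mu>. normal_in_base b (\<phi> x)" if "b > 1" for b :: nat
  proof -
    have "strict_mono_on {1..} (\<lambda>n. b ^ n)"
      using that by (intro strict_mono_onI power_strict_increasing) auto
    from equi[OF this] show ?thesis
      by (simp add: normal_in_base_def)
  qed
  then have "AE x in \<mu>. \<forall>b::nat. b > 1 \<longrightarrow> normal_in_base b (\<phi> x)"
    by (subst AE_all_countable) auto
  with equi show ?thesis by blast
qed

end
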